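(* Let $f(x_1,x_2)=f_0(\max\{|x_1|,|x_2|\})$, where $f_0\in C(\mathbb{R}_+)\cap AC_{loc}(0,+\infty)$, $\lim_{t\to+\infty}tf_0(t)=0$ and $\int_0^\infty t|f_0(t)|\,dt<\infty$. If for all $y=(y_1,y_2)\in\mathbb{R}^2$ $$\widehat f(y)=\int_{\mathbb{R}^2}f(x)e^{-i(x,y)}\,dx\ge0,$$ then $\widehat f_1(x)\ge0$ for all $x\in\mathbb{R}$, where $$f_1(x)=|x|f_0(|x|)+\int_{|x|}^\infty f_0(t)\,dt\qquad\Big(=-\int_{|x|}^\infty tf_0'(t)\,dt\Big),\quad x\in\mathbb{R}.$$
   Context: $\mathbb{R}_+=[0,+\infty)$; $AC_{loc}(0,+\infty)$ denotes functions absolutely continuous on every compact subinterval of $(0,+\infty)$; $(x,y)=x_1y_1+x_2y_2$. For a function $h\in L_1(\mathbb{R})$, $\widehat h(y)=\int_{\mathbb{R}}h(x)e^{-ixy}\,dx$. The last integral expression for $f_1$ is understood as an improper integral at $+\infty$. *)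

theory Defs
  imports "HOL-Analysis.Analysis"
begin

text \<open>Only the values of \<open>f0\<close> on \<open>[0, \<infinity>)\<close> are relevant below; \<open>f0\<close> may be complex-valued.\<close>

definition absolutely_continuous_on :: "real set \<Rightarrow> (real \<Rightarrow> 'a::real_normed_vector) \<Rightarrow> bool" where
  "absolutely_continuous_on S f \<longleftrightarrow>
     (\<forall>\<epsilon>>0. \<exists>\<delta>>0. \<forall>D :: (real \<times> real) set.
        finite D \<and> (\<forall>(u, v)\<in>D. u \<le> v \<and> {u..v} \<subseteq> S) \<and>
        disjoint_family_on (\<lambda>(u, v). {u<..<v}) D \<and> (\<Sum>(u, v)\<in>D. v - u) < \<delta>
        \<longrightarrow> (\<Sum>(u, v)\<in>D. norm (f v - f u)) < \<epsilon>)"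

definition AC_loc :: "(real \<Rightarrow> 'a::real_normed_vector) \<Rightarrow> bool" where
  "AC_loc f \<longleftrightarrow> (\<forall>a b. 0 < a \<and> a < b \<longrightarrow> absolutely_continuous_on {a..b} f)"

text \<open>Used at \<open>'a = real\<close> and \<open>'a = real \<times> real\<close>, where \<open>\<bullet>\<close> is \<open>x * y\<close> and
  \<open>x\<^sub>1 * y\<^sub>1 + x\<^sub>2 * y\<^sub>2\<close> respectively.\<close>

definition fourier :: "('a::euclidean_space \<Rightarrow> complex) \<Rightarrow> 'a \<Rightarrow> complex" where
  "fourier h y = (LINT x|lborel. h x * exp (- (\<i> * complex_of_real (x \<bullet> y))))"

definition max_fun :: "(real \<Rightarrow> complex) \<Rightarrow> real \<times> real \<Rightarrow> complex" where
  "max_fun f0 = (\<lambda>(x1, x2). f0 (max \<bar>x1\<bar> \<bar>x2\<bar>))"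

definition companion :: "(real \<Rightarrow> complex) \<Rightarrow> real \<Rightarrow> complex" where
  "companion f0 x = \<bar>x\<bar> *\<^sub>R f0 \<bar>x\<bar> + (LINT t:{\<bar>x\<bar>..}|lborel. f0 t)"

text \<open>Improper integral at \<open>+\<infinity>\<close>. The integrals over \<open>{a..T}\<close> are gauge integrals: a derivative
  of a function that is locally absolutely continuous on \<open>(0, \<infinity>)\<close> and continuous at \<open>0\<close> need
  not be Lebesgue integrable near \<open>0\<close> (even after multiplication by \<open>t\<close>), for instance for
  \<open>t * sin (1 / t\<^sup>2)\<close>.\<close>

definition has_improper_integral :: "(real \<Rightarrow> complex) \<Rightarrow> real \<Rightarrow> complex \<Rightarrow> bool" where
  "has_improper_integral g a I \<longleftrightarrow>
     (\<forall>T\<ge>a. g integrable_on {a..T}) \<and> ((\<lambda>T. integral {a..T} g) \<longlongrightarrow> I) at_top"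

end

theory Submission
  imports Defs
begin

text \<open>
  The positivity claim is a restriction to an axis. Integrating \<open>f0 (max \<bar>x\<bar> \<bar>y\<bar>)\<close> over \<open>y\<close> gives
  \<open>2 * \<bar>x\<bar> * f0 \<bar>x\<bar>\<close> from \<open>\<bar>y\<bar> \<le> \<bar>x\<bar>\<close> and twice the integral of \<open>f0\<close> over \<open>{\<bar>x\<bar>..}\<close> from the rest, that is,
  twice the companion of \<open>f0\<close> at \<open>x\<close> (\<open>max_fun_section\<close>). By Fubini, the Fourier transform of the
  plane function at \<open>(s, 0)\<close> is twice the Fourier transform of the companion at \<open>s\<close>
  (\<open>fourier_max_fun_axis\<close>), and the companion is integrable because the plane function is
  (\<open>integrable_max_fun\<close>).

  The formula for the companion as minus the improper integral of \<open>t * f0' t\<close> is an integration by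
  parts and rests on the fundamental theorem of calculus for absolutely continuous functions. A
  density is found by measure theory: locally an absolutely continuous function is a difference of
  monotone absolutely continuous functions (\<open>positive_variation_decomposition\<close>), and for these the
  Stieltjes measure is absolutely continuous with respect to Lebesgue measure
  (\<open>interval_measure_absolutely_continuous\<close>), so that it has a Radon-Nikodym derivative. By Lebesgue
  differentiation the density is the derivative almost everywhere
  (\<open>has_density_on_has_vector_derivative\<close>). Applied to \<open>t * f0 t\<close> on \<open>{a..T}\<close> with \<open>a > 0\<close>, this gives the
  value \<open>T * f0 T - a * f0 a\<close> minus the integral of \<open>f0\<close> over \<open>{a..T}\<close>. The case \<open>a = 0\<close> follows with
  Hake's theorem (\<open>Hake_left\<close>), since the gauge integral need not be absolutely convergent there, and
  \<open>T * f0 T\<close> tends to \<open>0\<close> for large \<open>T\<close>.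
\<close>

section \<open>Packings and absolute continuity\<close>

text \<open>The families occurring in the definition of absolute continuity, with degenerate intervals
  \<open>u = v\<close> excluded. A pair then determines a nonempty open interval, so packings of adjacent intervals have
  no pair in common, and sums over unions and images of packings split without double counting.\<close>

definition packing :: "real set \<Rightarrow> (real \<times> real) set \<Rightarrow> bool" where
  "packing S D \<longleftrightarrow> finite D \<and> (\<forall>(u, v)\<in>D. u < v \<and> {u..v} \<subseteq> S) \<and>
     disjoint_family_on (\<lambda>(u, v). {u<..<v}) D"

lemma absolutely_continuous_on_iff_packing:
  "absolutely_continuous_on S f \<longleftrightarrow>
     (\<forall>\<epsilon>>0. \<exists>\<delta>>0. \<forall>D. packing S D \<and> (\<Sum>(u, v)\<in>D. v - u) < \<delta> \<longrightarrow> (\<Sum>(u, v)\<in>D. norm (f v - f u)) < \<epsilon>)"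
  (is "?L \<longleftrightarrow> ?R")
proof
  assume ?L
  show ?R
  proof (intro allI impI)
    fix \<epsilon> :: real assume "\<epsilon> > 0"
    then obtain \<delta> where "\<delta> > 0" and *: "\<And>D. finite D \<and> (\<forall>(u, v)\<in>D. u \<le> v \<and> {u..v} \<subseteq> S) \<and>
        disjoint_family_on (\<lambda>(u, v). {u<..<v}) D \<and> (\<Sum>(u, v)\<in>D. v - u) < \<delta>
        \<Longrightarrow> (\<Sum>(u, v)\<in>D. norm (f v - f u)) < \<epsilon>"
      using \<open>?L\<close> unfolding absolutely_continuous_on_def by meson
    have "(\<Sum>(u, v)\<in>D. norm (f v - f u)) < \<epsilon>" if "packing S D" "(\<Sum>(u, v)\<in>D. v - u) < \<delta>" for D
      using that by (intro *) (force simp: packing_def)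
    then show "\<exists>\<delta>>0. \<forall>D. packing S D \<and> (\<Sum>(u, v)\<in>D. v - u) < \<delta> \<longrightarrow> (\<Sum>(u, v)\<in>D. norm (f v - f u)) < \<epsilon>"
      using \<open>\<delta> > 0\<close> by blast
  qed
next
  assume R: ?R
  show ?L
    unfolding absolutely_continuous_on_def
  proof (intro allI impI)
    fix \<epsilon> :: real assume "\<epsilon> > 0"
    with R obtain \<delta> where "\<delta> > 0" and *: "\<And>D. packing S D \<Longrightarrow> (\<Sum>(u, v)\<in>D. v - u) < \<delta>
        \<Longrightarrow> (\<Sum>(u, v)\<in>D. norm (f v - f u)) < \<epsilon>"
      by meson
    have "(\<Sum>(u, v)\<in>D. norm (f v - f u)) < \<epsilon>" 
      if D: "finite D" "\<forall>(u, v)\<in>D. u \<le> v \<and> {u..v} \<subseteq> S" "disjoint_family_on (\<lambda>(u, v). {u<..<v}) D" 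
        "(\<Sum>(u, v)\<in>D. v - u) < \<delta>" for D
    proof -
      define D' where "D' = {(u,v)\<in>D. u < v}"
      have sub: "D' \<subseteq> D" by (auto simp: D'_def)
      have deg: "fst q = snd q" if "q \<in> D - D'" for q using D(2) that by (fastforce simp: D'_def)
      have eq: "sum h D' = sum h D" if h: "\<And>u. h (u,u) = 0" for h :: "real \<times> real \<Rightarrow> real"
      proof (rule sum.mono_neutral_left[OF D(1) sub], rule ballI)
        fix q assume "q \<in> D - D'"
        from deg[OF this] h show "h q = 0" by (cases q) simp
      qed
      have "packing S D'" 
        unfolding packing_def using D(2) finite_subset[OF sub D(1)] disjoint_family_on_mono[OF sub D(3)]
        by (auto simp: D'_def)
      moreover have "(\<Sum>(u, v)\<in>D'. v - u) < \<delta>" using D(4) by (subst eq) auto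
      ultimately have "(\<Sum>(u, v)\<in>D'. norm (f v - f u)) < \<epsilon>" by (rule *)
      then show ?thesis by (subst (asm) eq) auto
    qed
    then show "\<exists>\<delta>>0. \<forall>D. finite D \<and> (\<forall>(u, v)\<in>D. u \<le> v \<and> {u..v} \<subseteq> S) \<and>
        disjoint_family_on (\<lambda>(u, v). {u<..<v}) D \<and> (\<Sum>(u, v)\<in>D. v - u) < \<delta>
        \<longrightarrow> (\<Sum>(u, v)\<in>D. norm (f v - f u)) < \<epsilon>"
      using \<open>\<delta> > 0\<close> by blast
  qed
qed

lemma absolutely_continuous_onE:
  assumes "absolutely_continuous_on S f" "\<epsilon> > 0"
  obtains \<delta> where "\<delta> > 0" and "\<And>D. packing S D \<Longrightarrow> (\<Sum>(u, v)\<in>D. v - u) < \<delta>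
        \<Longrightarrow> (\<Sum>(u, v)\<in>D. norm (f v - f u)) < \<epsilon>"
  using assms unfolding absolutely_continuous_on_iff_packing by meson

lemma packing_disjoint:
  assumes "packing S D" "p \<in> D" "q \<in> D" "max (fst p) (fst q) < min (snd p) (snd q)"
  shows "p = q"
proof (rule ccontr)
  assume "p \<noteq> q"
  then have "{fst p<..<snd p} \<inter> {fst q<..<snd q} = {}"
    using assms by (auto simp: packing_def disjoint_family_on_def split_def)
  moreover have "(max (fst p) (fst q) + min (snd p) (snd q)) / 2 \<in> {fst p<..<snd p} \<inter> {fst q<..<snd q}"
    using assms(4) by auto
  ultimately show False by blast
qed

lemma packing_length_le:
  assumes p: "packing S D" and S: "S \<in> sets borel" "emeasure lborel S < \<infinity>"
  shows "(\<Sum>(u, v)\<in>D. v - u) \<le> measure lborel S"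
proof -
  define F where "F = (\<lambda>(u, v). {u<..<v::real})"
  have sub: "F q \<subseteq> S" if "q \<in> D" for q using p that by (force simp: packing_def F_def)
  have "(\<Sum>(u, v)\<in>D. v - u) = (\<Sum>q\<in>D. measure lborel (F q))"
    using p by (intro sum.cong) (auto simp: F_def packing_def)
  also have "\<dots> = measure lborel (\<Union>q\<in>D. F q)"
  proof (rule measure_UNION'[symmetric])
    show "finite D" using p by (simp add: packing_def)
    show "F i \<in> fmeasurable lborel" for i
      by (cases i) (auto simp: F_def fmeasurable_def emeasure_lborel_box_eq box_real[symmetric] simp del: box_real)
    show "pairwise (\<lambda>i j. disjnt (F i) (F j)) D"
      using p by (auto simp: packing_def disjoint_family_on_def pairwise_def F_def disjnt_def)
  qed
  also have "\<dots> \<le> measure lborel S"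
    using p S sub by (intro measure_mono_fmeasurable) (auto simp: fmeasurable_def packing_def F_def)
  finally show ?thesis .
qed

text \<open>A monotone map may collapse intervals of a packing; these are discarded, and functions \<open>h\<close> that
  vanish on the diagonal do not notice. Used for \<open>min x\<close> and \<open>max x\<close>, which cut a packing at \<open>x\<close>,
  and for the retraction of the line onto a compact interval.\<close>

lemma packing_image:
  fixes \<kappa> :: "real \<Rightarrow> real"
  assumes p: "packing S D" and mono: "mono \<kappa>" 
    and T: "\<And>u v. (u,v) \<in> D \<Longrightarrow> \<kappa> u < \<kappa> v \<Longrightarrow> {\<kappa> u..\<kappa> v} \<subseteq> T"
  obtains E where "packing T E"
    "\<And>h::real\<times>real\<Rightarrow>real. (\<And>w. h (w,w) = 0) \<Longrightarrow> sum h E = (\<Sum>(u,v)\<in>D. h (\<kappa> u, \<kappa> v))"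
proof -
  define g where "g = (\<lambda>(u,v). (\<kappa> u, \<kappa> v))"
  define D' where "D' = {q\<in>D. \<kappa> (fst q) < \<kappa> (snd q)}"
  define E where "E = g ` D'"
  have fin: "finite D" "finite D'" using p by (auto simp: packing_def D'_def)
  have key: "p = q" if q: "p \<in> D'" "q \<in> D'" "max (\<kappa> (fst p)) (\<kappa> (fst q)) < min (\<kappa> (snd p)) (\<kappa> (snd q))" for p q
  proof (rule packing_disjoint[OF p])
    have "\<not> b \<le> a" if "\<kappa> a < \<kappa> b" for a b
      using monoD[OF mono, of b a] that by auto
    then show "max (fst p) (fst q) < min (snd p) (snd q)"
      using q(3) by (auto simp: not_le)
  qed (use q in \<open>auto simp: D'_def\<close>)
  have inj: "inj_on g D'"
  proof (rule inj_onI)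
    fix p q assume pq: "p \<in> D'" "q \<in> D'" "g p = g q"
    show "p = q" by (rule key[OF pq(1,2)]) (use pq in \<open>auto simp: g_def D'_def split: prod.splits\<close>)
  qed
  show thesis
  proof
    show "packing T E"
      unfolding packing_def
    proof (intro conjI)
      show "finite E" using fin by (simp add: E_def)
      show "\<forall>(u, v)\<in>E. u < v \<and> {u..v} \<subseteq> T"
        using T by (force simp: E_def D'_def g_def split: prod.splits)
      show "disjoint_family_on (\<lambda>(u, v). {u<..<v}) E"
        unfolding disjoint_family_on_def
      proof (intro ballI impI equals0I)
        fix m n z assume "m \<in> E" "n \<in> E" "m \<noteq> n"
          and z: "z \<in> (case m of (u, v) \<Rightarrow> {u<..<v}) \<inter> (case n of (u, v) \<Rightarrow> {u<..<v})"
        then obtain p q where pq: "p \<in> D'" "q \<in> D'" "m = g p" "n = g q" "p \<noteq> q" by (auto simp: E_def)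
        moreover have "p = q"
          by (rule key[OF pq(1,2)]) (use z pq in \<open>simp add: g_def split_def\<close>)
        ultimately show False by simp
      qed
    qed
    show "sum h E = (\<Sum>(u,v)\<in>D. h (\<kappa> u, \<kappa> v))" if h: "\<And>w. h (w,w) = 0" for h :: "real\<times>real\<Rightarrow>real"
    proof -
      have "sum h E = (\<Sum>q\<in>D'. h (g q))" unfolding E_def using inj by (simp add: sum.reindex)
      also have "\<dots> = (\<Sum>q\<in>D. h (g q))"
      proof (rule sum.mono_neutral_left[OF fin(1)])
        show "\<forall>i\<in>D - D'. h (g i) = 0"
        proof
          fix i assume i: "i \<in> D - D'"
          then have "fst i < snd i" using p by (auto simp: packing_def)
          then have "\<kappa> (fst i) = \<kappa> (snd i)" using monoD[OF mono, of "fst i" "snd i"] i by (auto simp: D'_def)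
          then show "h (g i) = 0" using h by (cases i) (simp add: g_def)
        qed
      qed (auto simp: D'_def)
      finally show ?thesis by (simp add: g_def split_def)
    qed
  qed
qed

lemma absolutely_continuous_on_compose_contraction:
  fixes \<kappa> :: "real \<Rightarrow> real"
  assumes ac: "absolutely_continuous_on T f" and mono: "mono \<kappa>" 
    and contr: "\<And>u v. u \<le> v \<Longrightarrow> \<kappa> v - \<kappa> u \<le> v - u" and T: "\<And>u v. {\<kappa> u..\<kappa> v} \<subseteq> T"
  shows "absolutely_continuous_on S (\<lambda>x. f (\<kappa> x))"
  unfolding absolutely_continuous_on_iff_packing
proof (intro allI impI)
  fix \<epsilon> :: real assume "\<epsilon> > 0"
  obtain \<delta> where "\<delta> > 0" and \<delta>: "\<And>D. packing T D \<Longrightarrow> (\<Sum>(u, v)\<in>D. v - u) < \<delta>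
        \<Longrightarrow> (\<Sum>(u, v)\<in>D. norm (f v - f u)) < \<epsilon>"
    by (rule absolutely_continuous_onE[OF ac \<open>\<epsilon> > 0\<close>]) (rule that)
  have "(\<Sum>(u, v)\<in>D. norm (f (\<kappa> v) - f (\<kappa> u))) < \<epsilon>" if D: "packing S D" "(\<Sum>(u, v)\<in>D. v - u) < \<delta>" for D
  proof -
    obtain E where E: "packing T E"
      "\<And>h::real\<times>real\<Rightarrow>real. (\<And>w. h (w,w) = 0) \<Longrightarrow> sum h E = (\<Sum>(u,v)\<in>D. h (\<kappa> u, \<kappa> v))"
      using packing_image[OF D(1) mono T] by metis
    have "(\<Sum>(u,v)\<in>E. v - u) = (\<Sum>(u,v)\<in>D. \<kappa> v - \<kappa> u)" by (subst E(2)) auto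
    also have "\<dots> \<le> (\<Sum>(u, v)\<in>D. v - u)" 
      using D(1) by (intro sum_mono) (auto simp: packing_def intro!: contr dest!: bspec)
    finally have "(\<Sum>(u, v)\<in>E. norm (f v - f u)) < \<epsilon>" using D(2) by (intro \<delta> E) auto
    also have "(\<Sum>(u, v)\<in>E. norm (f v - f u)) = (\<Sum>(u, v)\<in>D. norm (f (\<kappa> v) - f (\<kappa> u)))"
      by (subst E(2)) auto
    finally show ?thesis .
  qed
  then show "\<exists>\<delta>>0. \<forall>D. packing S D \<and> (\<Sum>(u, v)\<in>D. v - u) < \<delta> \<longrightarrow> (\<Sum>(u, v)\<in>D. norm (f (\<kappa> v) - f (\<kappa> u))) < \<epsilon>"
    using \<open>\<delta> > 0\<close> by blast
qed

lemma packing_singleton: "u < v \<Longrightarrow> packing S {(u,v)} \<longleftrightarrow> {u..v} \<subseteq> S"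
  by (auto simp: packing_def disjoint_family_on_def)

lemma absolutely_continuous_on_imp_continuous_on:
  fixes f :: "real \<Rightarrow> 'a::real_normed_vector"
  assumes ac: "absolutely_continuous_on S f" and S: "is_interval S"
  shows "continuous_on S f"
  unfolding continuous_on_iff
proof (intro ballI allI impI)
  fix x and \<epsilon> :: real assume x: "x \<in> S" and "\<epsilon> > 0"
  obtain \<delta> where "\<delta> > 0" and \<delta>: "\<And>D. packing S D \<Longrightarrow> (\<Sum>(u, v)\<in>D. v - u) < \<delta>
        \<Longrightarrow> (\<Sum>(u, v)\<in>D. norm (f v - f u)) < \<epsilon>"
    by (rule absolutely_continuous_onE[OF ac \<open>\<epsilon> > 0\<close>]) (rule that)
  have *: "dist (f u) (f v) < \<epsilon>" if "u < v" "u \<in> S" "v \<in> S" "dist u v < \<delta>" for u v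
  proof -
    have "{u..v} \<subseteq> S" using mem_is_interval_1_I[OF S that(2,3)] by auto
    with \<delta>[of "{(u,v)}"] show ?thesis using that by (simp add: packing_singleton dist_norm norm_minus_commute)
  qed
  have "dist (f y) (f x) < \<epsilon>" if "y \<in> S" "dist y x < \<delta>" for y
    using *[of x y] *[of y x] that x \<open>\<epsilon> > 0\<close> by (cases x y rule: linorder_cases) (auto simp: dist_commute)
  then show "\<exists>d>0. \<forall>x'\<in>S. dist x' x < d \<longrightarrow> dist (f x') (f x) < \<epsilon>"
    using \<open>\<delta> > 0\<close> by (intro exI[of _ \<delta>]) simp
qed

section \<open>Densities of monotone functions\<close>

text \<open>A null set lies in an open set of small length, which is an increasing union of finite unions of
  compact intervals. Each finite union can be subdivided into a packing of small total length
  together with single points, and the Stieltjes measure of that packing is the sum that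
  absolute continuity controls.\<close>

lemma interval_measure_absolutely_continuous:
  fixes R :: "real \<Rightarrow> real"
  assumes mono: "mono R" and ac: "absolutely_continuous_on UNIV R"
  shows "absolutely_continuous lborel (interval_measure R)"
  unfolding absolutely_continuous_def
proof
  let ?\<mu> = "interval_measure R"
  have cont: "continuous_on UNIV R" using absolutely_continuous_on_imp_continuous_on[OF ac] by simp
  fix N :: "real set" assume N: "N \<in> null_sets lborel"
  have "emeasure ?\<mu> N \<le> 0 + ennreal \<epsilon>" if "\<epsilon> > 0" for \<epsilon> :: real
  proof -
    obtain \<delta> where "\<delta> > 0" and \<delta>: "\<And>D. packing UNIV D \<Longrightarrow> (\<Sum>(u, v)\<in>D. v - u) < \<delta>
        \<Longrightarrow> (\<Sum>(u, v)\<in>D. norm (R v - R u)) < \<epsilon>"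
      by (rule absolutely_continuous_onE[OF ac \<open>\<epsilon> > 0\<close>]) (rule that)
    obtain U where U: "open U" "N \<subseteq> U" "emeasure lborel (U - N) < \<delta>"
      by (rule outer_regular_lborel[of N \<delta>]) (use N \<open>\<delta> > 0\<close> in \<open>simp_all add: null_sets_def\<close>)
    have eU: "emeasure lborel U < \<delta>"
      using U N by (simp add: emeasure_Diff_null_set borel_open)
    have fin_le: "emeasure ?\<mu> (\<Union>\<F>) \<le> ennreal \<epsilon>" 
      if F: "finite \<F>" "\<And>s. s \<in> \<F> \<Longrightarrow> \<exists>a b. s = cbox a b" "\<Union>\<F> \<subseteq> U" for \<F> :: "real set set"
    proof -
      obtain p where p: "p division_of \<Union>\<F>" using elementary_unions_intervals[OF F(1,2)] by metis
      note pD = division_ofD[OF p]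
      \<comment> \<open>Intervals of the division are turned into pairs of endpoints; one-point intervals carry no mass.\<close>
      define g where "g K = (Inf K, Sup K :: real)" for K :: "real set"
      define p' where "p' = {K\<in>p. Inf K < Sup K}"
      have K: "K = {Inf K..Sup K}" "Inf K \<le> Sup K" if "K \<in> p" for K
        using pD(3,4)[OF that] by (auto simp: cbox_interval)
      have inj: "inj_on g p'"
        by (rule inj_onI) (metis (no_types, lifting) K(1) g_def mem_Collect_eq p'_def prod.inject)
      define D where "D = g ` p'"
      have pack: "packing U D"
        unfolding packing_def
      proof (intro conjI)
        show "finite D" using pD(1) by (simp add: D_def p'_def)
        show "\<forall>(u, v)\<in>D. u < v \<and> {u..v} \<subseteq> U"
        proof safe
          fix u v assume "(u, v) \<in> D"
          then obtain L where L: "L \<in> p" "Inf L < Sup L" "u = Inf L" "v = Sup L" by (auto simp: D_def p'_def g_def)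
          show "u < v" using L by simp
          have "{u..v} \<subseteq> U" using K(1)[OF L(1)] pD(2)[OF L(1)] F(3) L(3,4) by simp
          then show "x \<in> U" if "x \<in> {u..v}" for x using that by blast
        qed
        show "disjoint_family_on (\<lambda>(u, v). {u<..<v}) D"
          unfolding disjoint_family_on_def
        proof (intro ballI impI)
          fix m n assume "m \<in> D" "n \<in> D" "m \<noteq> n"
          then obtain K L where KL: "K \<in> p" "L \<in> p" "m = g K" "n = g L" "K \<noteq> L" by (auto simp: D_def p'_def)
          have "interior K = {Inf K<..<Sup K}" if "K \<in> p" for K
            using arg_cong[OF K(1)[OF that], of interior] by simp
          note this[OF KL(1)] this[OF KL(2)]
          with pD(5)[OF KL(1,2,5)] show "(case m of (u, v) \<Rightarrow> {u<..<v}) \<inter> (case n of (u, v) \<Rightarrow> {u<..<v}) = {}"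
            by (simp add: KL(3,4) g_def)
        qed
      qed
      have "(\<Sum>(u, v)\<in>D. v - u) \<le> measure lborel U"
        using eU U(1) by (intro packing_length_le[OF pack]) (auto intro: less_trans)
      also have "\<dots> < \<delta>" using eU \<open>\<delta> > 0\<close> unfolding measure_def
        by (metis ennreal_enn2real ennreal_less_iff enn2real_nonneg less_trans ennreal_less_top)
      finally have small: "(\<Sum>(u, v)\<in>D. norm (R v - R u)) < \<epsilon>"
        using pack by (intro \<delta>) (auto simp: packing_def)
      have eK: "emeasure ?\<mu> K = ennreal (R (Sup K) - R (Inf K))" if "K \<in> p" for K
        using emeasure_interval_measure_Icc[of "Inf K" "Sup K" R] mono cont K[OF that] by (metis monoD)
      have Kb: "K \<in> sets borel" if "K \<in> p" for K using pD(4)[OF that] by auto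
      have "emeasure ?\<mu> (\<Union>\<F>) = emeasure ?\<mu> (\<Union>K\<in>p. K)" using pD(6) by simp
      also have "\<dots> \<le> (\<Sum>K\<in>p. emeasure ?\<mu> K)"
        using pD(1) Kb by (intro emeasure_subadditive_finite) auto
      also have "\<dots> = (\<Sum>K\<in>p. ennreal (R (Sup K) - R (Inf K)))" using eK by simp
      also have "\<dots> = ennreal (\<Sum>K\<in>p. R (Sup K) - R (Inf K))"
        using mono K(2) by (intro sum_ennreal) (auto simp: mono_def)
      also have "(\<Sum>K\<in>p. R (Sup K) - R (Inf K)) = (\<Sum>K\<in>p'. R (Sup K) - R (Inf K))"
      proof (rule sum.mono_neutral_right[OF pD(1)])
        show "\<forall>K\<in>p - p'. R (Sup K) - R (Inf K) = 0"
        proof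
          fix K assume "K \<in> p - p'"
          then have "Inf K = Sup K" using K(2)[of K] by (auto simp: p'_def)
          then show "R (Sup K) - R (Inf K) = 0" by simp
        qed
      qed (auto simp: p'_def)
      also have "\<dots> = (\<Sum>(u, v)\<in>D. R v - R u)"
        unfolding D_def sum.reindex[OF inj] by (simp add: g_def o_def)
      also have "\<dots> \<le> (\<Sum>(u, v)\<in>D. norm (R v - R u))" by (intro sum_mono) auto
      finally show ?thesis using small by (meson ennreal_leI less_imp_le order_trans)
    qed
    have "emeasure ?\<mu> U \<le> ennreal \<epsilon>"
    proof -
      obtain \<D> where D: "countable \<D>" "\<D> \<subseteq> Pow U" "\<And>X. X \<in> \<D> \<Longrightarrow> \<exists>a b. X = cbox a b" "\<Union>\<D> = U"
        using open_countable_Union_open_cbox[OF U(1)] by metis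
      show ?thesis
      proof (cases "\<D> = {}")
        case True then show ?thesis using D by auto
      next
        case False
        define B where "B = from_nat_into \<D>"
        have B: "range B = \<D>" using range_from_nat_into[OF False D(1)] by (simp add: B_def)
        have BD: "B i \<in> \<D>" for i using B by blast
        have s: "B i \<in> sets ?\<mu>" for i using D(3)[OF BD[of i]] by auto
        have "(SUP n. emeasure ?\<mu> (\<Union>i\<le>n. B i)) = emeasure ?\<mu> (\<Union>n. \<Union>i\<le>n. B i)"
        proof (rule SUP_emeasure_incseq)
          show "range (\<lambda>n. \<Union>i\<le>n. B i) \<subseteq> sets ?\<mu>" using s by blast
          show "incseq (\<lambda>n. \<Union>i\<le>n. B i)" by (intro incseq_SucI UN_mono) auto
        qed
        also have "(\<Union>n. \<Union>i\<le>n. B i) = \<Union>(range B)" by auto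
        also have "\<dots> = U" unfolding B D(4) ..
        finally have "emeasure ?\<mu> U = (SUP n. emeasure ?\<mu> (\<Union>i\<le>n. B i))" by simp
        also have "\<dots> \<le> ennreal \<epsilon>"
        proof (rule SUP_least, rule fin_le)
          fix n
          show "\<exists>a b. s = cbox a b" if "s \<in> B ` {..n}" for s using that D(3)[OF BD] by blast
          show "\<Union>(B ` {..n}) \<subseteq> U" using D(2) BD by blast
        qed simp
        finally show ?thesis .
      qed
    qed
    moreover have "emeasure ?\<mu> N \<le> emeasure ?\<mu> U" using U by (intro emeasure_mono) auto
    ultimately show ?thesis by simp
  qed
  then have "emeasure ?\<mu> N \<le> 0" by (rule ennreal_le_epsilon)
  then show "N \<in> null_sets ?\<mu>" using N by (auto simp: null_sets_def)
qed

text \<open>The conclusion of the fundamental theorem of calculus without any mention of derivatives.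
  In this form it passes to differences and to adjacent intervals.\<close>

definition has_density_on :: "real \<Rightarrow> real \<Rightarrow> (real \<Rightarrow> 'a::euclidean_space) \<Rightarrow> bool" where
  "has_density_on a b F \<longleftrightarrow>
     (\<exists>g. g absolutely_integrable_on {a..b} \<and> (\<forall>x\<in>{a..b}. (g has_integral F x - F a) {a..x}))"

text \<open>The Radon-Nikodym derivative of the Stieltjes measure of \<open>Q\<close>. Composing \<open>Q\<close> with the retraction
  \<open>\<kappa>\<close> of the line onto \<open>{a..b}\<close> makes it monotone and absolutely continuous everywhere,
  and the measure finite.\<close>

lemma mono_absolutely_continuous_has_density:
  fixes Q :: "real \<Rightarrow> real"
  assumes "a \<le> b" and mono: "mono_on {a..b} Q" and ac: "absolutely_continuous_on {a..b} Q"
  shows "has_density_on a b Q"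
proof -
  define \<kappa> where "\<kappa> x = max a (min b x)" for x
  define R where "R x = Q (\<kappa> x)" for x
  have \<kappa>: "\<kappa> x \<in> {a..b}" "x \<in> {a..b} \<Longrightarrow> \<kappa> x = x" for x using \<open>a \<le> b\<close> by (auto simp: \<kappa>_def)
  have m\<kappa>: "mono \<kappa>" by (auto simp: mono_def \<kappa>_def)
  have mR: "mono R"
    unfolding R_def by (intro monoI mono_onD[OF mono] \<kappa> monoD[OF m\<kappa>])
  have R: "Q a \<le> R x" "R x \<le> Q b" for x
    unfolding R_def using mono_onD[OF mono, of a "\<kappa> x"] mono_onD[OF mono, of "\<kappa> x" b] \<kappa>(1)[of x] \<open>a \<le> b\<close>
    by auto
  have acR: "absolutely_continuous_on UNIV R"
    unfolding R_def
  proof (rule absolutely_continuous_on_compose_contraction[OF ac m\<kappa>])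
    show "\<kappa> v - \<kappa> u \<le> v - u" if "u \<le> v" for u v using that by (auto simp: \<kappa>_def)
    show "{\<kappa> u..\<kappa> v} \<subseteq> {a..b}" for u v using \<kappa>(1)[of u] \<kappa>(1)[of v] by auto
  qed
  have cont: "continuous_on UNIV R" using absolutely_continuous_on_imp_continuous_on[OF acR] by simp
  let ?\<mu> = "interval_measure R"
  have Icc: "emeasure ?\<mu> {x..y} = ennreal (R y - R x)" if "x \<le> y" for x y
    using emeasure_interval_measure_Icc[OF that, of R] mR cont by (metis monoD)
  have "emeasure ?\<mu> UNIV = (SUP n. emeasure ?\<mu> {- real n..real n})"
  proof (subst SUP_emeasure_incseq)
    have "\<exists>n. - real n \<le> x \<and> x \<le> real n" for x
      using real_arch_simple[of "\<bar>x\<bar>"] by (auto simp: abs_le_iff) (metis minus_le_iff)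
    then have "(\<Union>n. {- real n..real n}) = UNIV" by auto
    then show "emeasure ?\<mu> UNIV = emeasure ?\<mu> (\<Union>n. {- real n..real n})" by simp
  qed (auto simp: incseq_def)
  also have "\<dots> \<le> ennreal (Q b - Q a)"
  proof (rule SUP_least)
    fix n :: nat
    show "emeasure ?\<mu> {- real n..real n} \<le> ennreal (Q b - Q a)"
      using R(1)[of "- real n"] R(2)[of "real n"] by (subst Icc) (auto intro!: ennreal_leI)
  qed
  finally have "emeasure ?\<mu> UNIV < \<infinity>" by (rule le_less_trans) simp
  then have fin: "finite_measure ?\<mu>" by (intro finite_measureI) auto
  have acm: "absolutely_continuous lborel ?\<mu>" by (rule interval_measure_absolutely_continuous[OF mR acR])
  have sets: "sets ?\<mu> = sets lborel" by simp
  obtain D where D: "D \<in> borel_measurable lborel" "AE x in lborel. RN_deriv lborel ?\<mu> x = ennreal (D x)"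
    "\<And>x. 0 \<le> D x"
    using sigma_finite_measure.real_RN_deriv[OF sigma_finite_lborel fin acm sets] by metis
  have D_int: "(D has_integral Q x - Q a) {a..x}" if x: "x \<in> {a..b}" for x
  proof -
    have "emeasure ?\<mu> {a..x} = emeasure (density lborel (RN_deriv lborel ?\<mu>)) {a..x}"
      using sigma_finite_measure.density_RN_deriv[OF sigma_finite_lborel acm sets] by simp
    also have "\<dots> = (\<integral>\<^sup>+t. RN_deriv lborel ?\<mu> t * indicator {a..x} t \<partial>lborel)"
      by (intro emeasure_density) auto
    also have "\<dots> = (\<integral>\<^sup>+t. ennreal (D t * indicator {a..x} t) \<partial>lborel)"
      using D(2) by (intro nn_integral_cong_AE) (auto elim!: eventually_mono simp: indicator_def)
    finally have "(\<integral>\<^sup>+t. ennreal (D t * indicator {a..x} t) \<partial>lborel) = ennreal (R x - R a)"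
      using Icc[of a x] x by simp
    moreover have "R x - R a = Q x - Q a" using x \<open>a \<le> b\<close> by (simp add: R_def \<kappa>(2))
    moreover have "Q a \<le> Q x" using mono_onD[OF mono, of a x] x by auto
    ultimately have "((\<lambda>t. D t * indicator {a..x} t) has_integral (Q x - Q a)) UNIV"
      using D(1,3) by (intro nn_integral_has_integral) auto
    then have "((\<lambda>t. if t \<in> {a..x} then D t else 0) has_integral (Q x - Q a)) UNIV"
      by (rule has_integral_eq[rotated]) (auto simp: indicator_def)
    then show ?thesis by (simp only: has_integral_restrict_UNIV)
  qed
  have "D absolutely_integrable_on {a..b}"
    using D_int[of b] D(3) \<open>a \<le> b\<close> by (intro nonnegative_absolutely_integrable_1) auto
  then show ?thesis unfolding has_density_on_def using D_int by blast
qed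

lemma has_density_on_diff:
  assumes "has_density_on a b F" "has_density_on a b G"
  shows "has_density_on a b (\<lambda>x. F x - G x)"
proof -
  from assms obtain f g where fg: "f absolutely_integrable_on {a..b}" "g absolutely_integrable_on {a..b}"
    "\<And>x. x \<in> {a..b} \<Longrightarrow> (f has_integral F x - F a) {a..x}" 
    "\<And>x. x \<in> {a..b} \<Longrightarrow> (g has_integral G x - G a) {a..x}"
    unfolding has_density_on_def by metis
  have "((\<lambda>t. f t - g t) has_integral (F x - G x) - (F a - G a)) {a..x}" if "x \<in> {a..b}" for x
    using has_integral_diff[OF fg(3,4)[OF that]] by (simp add: algebra_simps)
  with set_integral_diff(1)[OF fg(1,2)] show ?thesis
    unfolding has_density_on_def by blast
qed

lemma has_density_on_combine:
  assumes "has_density_on a b F" "has_density_on b c F" "a \<le> b" "b \<le> c"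
  shows "has_density_on a c F"
proof -
  from assms obtain f g where fg: "f absolutely_integrable_on {a..b}" "g absolutely_integrable_on {b..c}"
    "\<And>x. x \<in> {a..b} \<Longrightarrow> (f has_integral F x - F a) {a..x}" 
    "\<And>x. x \<in> {b..c} \<Longrightarrow> (g has_integral F x - F b) {b..x}"
    unfolding has_density_on_def by metis
  define h where "h x = (if x \<le> b then f x else g x)" for x
  have 1: "h absolutely_integrable_on {a..b}"
    by (rule absolutely_integrable_spike[OF fg(1), of "{}"]) (auto simp: h_def)
  have 2: "h absolutely_integrable_on {b..c}"
    by (rule absolutely_integrable_spike[OF fg(2), of "{b}"]) (auto simp: h_def)
  have i1: "(h has_integral F x - F a) {a..x}" if "x \<in> {a..b}" for x
    by (rule has_integral_spike[OF _ _ fg(3)[OF that], of "{}"]) (use that in \<open>auto simp: h_def\<close>)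
  have i2: "(h has_integral F x - F b) {b..x}" if "x \<in> {b..c}" for x
    by (rule has_integral_spike[OF _ _ fg(4)[OF that], of "{b}"]) (use that in \<open>auto simp: h_def\<close>)
  show ?thesis
    unfolding has_density_on_def
  proof (intro exI[of _ h] conjI ballI)
    have "h absolutely_integrable_on {a..b} \<union> {b..c}"
      using 1 2 by (rule set_integrable_Un) auto
    then show "h absolutely_integrable_on {a..c}" using assms(3,4) by (simp add: ivl_disj_un_two_touch)
    fix x assume x: "x \<in> {a..c}"
    show "(h has_integral F x - F a) {a..x}"
    proof (cases "x \<le> b")
      case False
      then have "(h has_integral (F b - F a) + (F x - F b)) {a..x}"
        using assms(3) x by (intro has_integral_combine[OF _ _ i1 i2]) auto
      then show ?thesis by simp
    qed (use i1 x in auto)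
  qed
qed

section \<open>Densities of absolutely continuous functions\<close>

lemma packing_subset: "packing S D \<Longrightarrow> S \<subseteq> T \<Longrightarrow> packing T D"
  by (force simp: packing_def)

lemma packing_UNION:
  assumes D: "packing W D" and E: "\<And>q. q \<in> D \<Longrightarrow> packing {fst q..snd q} (E q)"
  shows "packing W (\<Union>q\<in>D. E q)" 
    and "\<And>h. sum h (\<Union>q\<in>D. E q) = (\<Sum>q\<in>D. sum h (E q) :: real)"
proof -
  have fin: "finite D" "\<And>q. q \<in> D \<Longrightarrow> finite (E q)" using D E by (auto simp: packing_def)
  have sub: "fst q \<le> fst r" "fst r < snd r" "snd r \<le> snd q" if "q \<in> D" "r \<in> E q" for q r
    using E[OF that(1)] that(2) by (fastforce simp: packing_def)+
  have W: "{fst q..snd q} \<subseteq> W" if "q \<in> D" for q using D that by (cases q) (force simp: packing_def)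
  have eq: "p = q" if "p \<in> D" "q \<in> D" "r \<in> E p" "s \<in> E q" "max (fst r) (fst s) < min (snd r) (snd s)" for p q r s
    by (rule packing_disjoint[OF D that(1,2)])
      (use sub[OF that(1,3)] sub[OF that(2,4)] that(5) in auto)
  show "packing W (\<Union>q\<in>D. E q)"
    unfolding packing_def
  proof (intro conjI)
    show "finite (\<Union>q\<in>D. E q)" using fin by simp
    show "\<forall>(u, v)\<in>\<Union>q\<in>D. E q. u < v \<and> {u..v} \<subseteq> W"
    proof safe
      fix u v q assume q: "q \<in> D" "(u, v) \<in> E q"
      note s = sub[OF q, simplified]
      show "u < v" by (rule s)
      show "x \<in> W" if "x \<in> {u..v}" for x using W[OF q(1)] s that by auto
    qed
    show "disjoint_family_on (\<lambda>(u, v). {u<..<v}) (\<Union>q\<in>D. E q)"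
      unfolding disjoint_family_on_def
    proof (intro ballI impI equals0I)
      fix r s z assume "r \<in> (\<Union>q\<in>D. E q)" "s \<in> (\<Union>q\<in>D. E q)" "r \<noteq> s"
        and z: "z \<in> (case r of (u, v) \<Rightarrow> {u<..<v}) \<inter> (case s of (u, v) \<Rightarrow> {u<..<v})"
      then obtain p q where pq: "p \<in> D" "q \<in> D" "r \<in> E p" "s \<in> E q" by auto
      have o: "max (fst r) (fst s) < min (snd r) (snd s)" using z by (simp add: split_def)
      have "p = q" by (rule eq[OF pq o])
      then have "r = s" using packing_disjoint[OF E[OF pq(1)] pq(3) _ o] pq(4) by simp
      with \<open>r \<noteq> s\<close> show False ..
    qed
  qed
  have "E p \<inter> E q = {}" if "p \<in> D" "q \<in> D" "p \<noteq> q" for p q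
  proof (rule equals0I)
    fix r assume "r \<in> E p \<inter> E q"
    then show False using eq[OF that(1,2), of r r] sub(2)[OF that(1), of r] that(3) by auto
  qed
  then show "sum h (\<Union>q\<in>D. E q) = (\<Sum>q\<in>D. sum h (E q) :: real)" for h
    using fin by (intro sum.UNION_disjoint) auto
qed

lemma packing_insert:
  assumes "packing {a..x} D" "a \<le> x" "x < y"
  shows "packing {a..y} (insert (x,y) D)" "(x,y) \<notin> D"
proof -
  have le: "a \<le> u" "u < v" "v \<le> x" if "(u,v) \<in> D" for u v
    using assms(1) that by (fastforce simp: packing_def)+
  show "(x,y) \<notin> D" using le(3)[of x y] assms(3) by auto
  show "packing {a..y} (insert (x,y) D)"
    unfolding packing_def
  proof (intro conjI)
    show "finite (insert (x, y) D)" using assms(1) by (simp add: packing_def)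
    show "\<forall>(u, v)\<in>insert (x, y) D. u < v \<and> {u..v} \<subseteq> {a..y}"
      using le assms(2,3) by fastforce
    have "{x<..<y} \<inter> {u<..<v} = {}" if "(u,v) \<in> D" for u v using le(3)[OF that] by auto
    then have "{x<..<y} \<inter> (\<Union>(u, v)\<in>D. {u<..<v}) = {}" by blast
    then show "disjoint_family_on (\<lambda>(u, v). {u<..<v}) (insert (x, y) D)"
      using assms(1) \<open>(x,y) \<notin> D\<close> by (simp add: packing_def disjoint_family_on_insert)
  qed
qed

text \<open>Jordan decomposition: \<open>P x\<close> is the positive variation of \<open>F\<close> on \<open>{a..x}\<close>. Adjoining the interval
  \<open>(x, y)\<close> to a packing of \<open>{a..x}\<close> shows that \<open>P - F\<close> is monotone. Cutting a packing of \<open>{a..v}\<close>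
  at \<open>u\<close> shows that \<open>P v - P u\<close> is nearly attained by a packing of \<open>{u..v}\<close>; replacing each interval
  of a packing by such a finer one transfers absolute continuity from \<open>F\<close> to \<open>P\<close>.\<close>

lemma positive_variation_decomposition:
  fixes F :: "real \<Rightarrow> real"
  assumes ac: "absolutely_continuous_on {a..b} F"
    and bound: "\<And>D. packing {a..b} D \<Longrightarrow> (\<Sum>(u, v)\<in>D. F v - F u) \<le> B"
  obtains P where "mono_on {a..b} P" "mono_on {a..b} (\<lambda>x. P x - F x)" "absolutely_continuous_on {a..b} P"
proof -
  define s where "s D = (\<Sum>(u, v)\<in>D. F v - F u)" for D
  define P where "P x = (SUP D\<in>{D. packing {a..x} D}. s D)" for x
  have ne: "{D. packing {a..x} D} \<noteq> {}" for x
    by (auto simp: packing_def disjoint_family_on_def intro: exI[of _ "{}"])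
  have upper: "s D \<le> P x" if "packing {a..x} D" "x \<le> b" for x D
    unfolding P_def
  proof (rule cSUP_upper)
    have "s E \<le> B" if "packing {a..x} E" for E
      unfolding s_def by (rule bound[OF packing_subset[OF that]]) (use \<open>x \<le> b\<close> in auto)
    then show "bdd_above (s ` {D. packing {a..x} D})" by (intro bdd_aboveI2[where M = B]) simp
  qed (use that in simp)
  have least: "P x \<le> c" if "\<And>D. packing {a..x} D \<Longrightarrow> s D \<le> c" for x c
    unfolding P_def by (rule cSUP_least[OF ne]) (use that in simp)
  have mono: "mono_on {a..b} P"
  proof (rule mono_onI)
    fix x y assume xy: "x \<in> {a..b}" "y \<in> {a..b}" "x \<le> y"
    show "P x \<le> P y" by (rule least, rule upper[OF packing_subset]) (use xy in auto)
  qed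
  have mono_diff: "mono_on {a..b} (\<lambda>x. P x - F x)"
  proof (rule mono_onI)
    fix x y assume xy: "x \<in> {a..b}" "y \<in> {a..b}" "x \<le> y"
    show "P x - F x \<le> P y - F y"
    proof (cases "x = y")
      case False
      have "P x \<le> P y - (F y - F x)"
      proof (rule least)
        fix D assume D: "packing {a..x} D"
        have "s (insert (x,y) D) \<le> P y"
          by (rule upper[OF packing_insert(1)[OF D]]) (use xy False in auto)
        moreover have "s (insert (x,y) D) = (F y - F x) + s D"
          unfolding s_def using packing_insert(2)[OF D, of y] xy False D by (subst sum.insert) (auto simp: packing_def)
        ultimately show "s D \<le> P y - (F y - F x)" by simp
      qed
      then show ?thesis by simp
    qed simp
  qed
  have local: "\<exists>E. packing {u..v} E \<and> P v - P u - \<eta> \<le> s E" if uv: "a \<le> u" "u < v" "v \<le> b" and "\<eta> > 0" for u v \<eta>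
  proof -
    have "\<not> P v \<le> P v - \<eta>" using \<open>\<eta> > 0\<close> by simp
    then obtain G where G: "packing {a..v} G" "s G > P v - \<eta>"
      using least[of v "P v - \<eta>"] by (meson not_le)
    have Gle: "a \<le> x" "x < y" "y \<le> v" if "(x,y) \<in> G" for x y
      using G(1) that by (fastforce simp: packing_def)+
    obtain E1 where E1: "packing {a..u} E1"
      "\<And>h::real\<times>real\<Rightarrow>real. (\<And>w. h (w,w) = 0) \<Longrightarrow> sum h E1 = (\<Sum>(x,y)\<in>G. h (min u x, min u y))"
      by (rule packing_image[OF G(1), of "min u" "{a..u}"]) (use Gle uv in \<open>auto simp: mono_def min_def\<close>)
    obtain E2 where E2: "packing {u..v} E2"
      "\<And>h::real\<times>real\<Rightarrow>real. (\<And>w. h (w,w) = 0) \<Longrightarrow> sum h E2 = (\<Sum>(x,y)\<in>G. h (max u x, max u y))"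
      by (rule packing_image[OF G(1), of "max u" "{u..v}"]) (use Gle uv in \<open>auto simp: mono_def max_def\<close>)
    have "s E1 + s E2 = (\<Sum>(x,y)\<in>G. F (min u y) - F (min u x)) + (\<Sum>(x,y)\<in>G. F (max u y) - F (max u x))"
      unfolding s_def by (subst E1(2), simp, subst E2(2), simp) simp
    also have "\<dots> = s G"
      unfolding s_def sum.distrib[symmetric] by (rule sum.cong) (auto simp: min_def max_def)
    finally have "s E1 + s E2 = s G" .
    moreover have "s E1 \<le> P u" by (rule upper[OF E1(1)]) (use uv in simp)
    ultimately show ?thesis using G(2) E2(1) by (intro exI[of _ E2]) simp
  qed
  have "absolutely_continuous_on {a..b} P"
    unfolding absolutely_continuous_on_iff_packing
  proof (intro allI impI)
    fix \<epsilon> :: real assume "\<epsilon> > 0"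
    then have "\<epsilon>/2 > 0" by simp
    obtain \<delta> where "\<delta> > 0" and \<delta>: "\<And>D. packing {a..b} D \<Longrightarrow> (\<Sum>(u, v)\<in>D. v - u) < \<delta>
          \<Longrightarrow> (\<Sum>(u, v)\<in>D. norm (F v - F u)) < \<epsilon>/2"
      by (rule absolutely_continuous_onE[OF ac \<open>\<epsilon>/2 > 0\<close>]) (rule that)
    have "(\<Sum>(u, v)\<in>D. norm (P v - P u)) < \<epsilon>" if D: "packing {a..b} D" "(\<Sum>(u, v)\<in>D. v - u) < \<delta>" for D
    proof -
      \<comment> \<open>The loss \<open>\<eta>\<close> allowed on each interval adds up to at most \<open>\<epsilon> / 2\<close>.\<close>
      define \<eta> where "\<eta> = \<epsilon> / (2 * (real (card D) + 1))"
      have "\<eta> > 0" using \<open>\<epsilon> > 0\<close> by (simp add: \<eta>_def)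
      have Dle: "a \<le> fst q" "fst q < snd q" "snd q \<le> b" if "q \<in> D" for q
        using D(1) that by (fastforce simp: packing_def)+
      have "\<forall>q\<in>D. \<exists>E. packing {fst q..snd q} E \<and> P (snd q) - P (fst q) - \<eta> \<le> s E"
        by (intro ballI local Dle \<open>\<eta> > 0\<close>)
      then obtain E where E: "\<And>q. q \<in> D \<Longrightarrow> packing {fst q..snd q} (E q)"
        "\<And>q. q \<in> D \<Longrightarrow> P (snd q) - P (fst q) - \<eta> \<le> s (E q)"
        by (metis bchoice)
      note U = packing_UNION[OF D(1) E(1)]
      let ?U = "\<Union>q\<in>D. E q"
      have "(\<Sum>(u, v)\<in>?U. v - u) = (\<Sum>q\<in>D. \<Sum>(u, v)\<in>E q. v - u)" by (rule U(2)) 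
      also have "\<dots> \<le> (\<Sum>q\<in>D. snd q - fst q)"
      proof (rule sum_mono)
        fix q assume q: "q \<in> D"
        have "(\<Sum>(u, v)\<in>E q. v - u) \<le> measure lborel {fst q..snd q}"
          by (rule packing_length_le[OF E(1)[OF q]]) (simp_all add: emeasure_lborel_Icc_eq)
        then show "(\<Sum>(u, v)\<in>E q. v - u) \<le> snd q - fst q" using Dle(2)[OF q] by simp
      qed
      also have "\<dots> < \<delta>" using D(2) by (simp add: split_def)
      finally have small: "(\<Sum>(u, v)\<in>?U. norm (F v - F u)) < \<epsilon>/2" by (intro \<delta> U(1))
      have "(\<Sum>(u, v)\<in>D. norm (P v - P u)) = (\<Sum>q\<in>D. P (snd q) - P (fst q))"
      proof (rule sum.cong[OF refl])
        fix q assume q: "q \<in> D"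
        have "P (fst q) \<le> P (snd q)" by (rule mono_onD[OF mono]) (use Dle[OF q] in auto)
        then show "(case q of (u, v) \<Rightarrow> norm (P v - P u)) = P (snd q) - P (fst q)" by (simp add: split_def)
      qed
      also have "\<dots> \<le> (\<Sum>q\<in>D. s (E q) + \<eta>)" by (rule sum_mono) (use E(2) in force)
      also have "\<dots> = s ?U + card D * \<eta>"
        unfolding s_def by (subst U(2)) (auto simp: sum.distrib)
      also have "s ?U \<le> (\<Sum>(u, v)\<in>?U. norm (F v - F u))" unfolding s_def by (rule sum_mono) auto
      also note small
      also have "card D * \<eta> \<le> \<epsilon>/2" using \<open>\<epsilon> > 0\<close> by (simp add: \<eta>_def field_simps)
      finally show ?thesis by simp
    qed
    then show "\<exists>\<delta>>0. \<forall>D. packing {a..b} D \<and> (\<Sum>(u, v)\<in>D. v - u) < \<delta> \<longrightarrow> (\<Sum>(u, v)\<in>D. norm (P v - P u)) < \<epsilon>"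
      using \<open>\<delta> > 0\<close> by (intro exI[of _ \<delta>]) simp
  qed
  with mono mono_diff show thesis by (rule that)
qed

lemma absolutely_continuous_on_subset:
  assumes ac: "absolutely_continuous_on T f" and sub: "S \<subseteq> T"
  shows "absolutely_continuous_on S f"
  unfolding absolutely_continuous_on_iff_packing
proof (intro allI impI)
  fix \<epsilon> :: real assume "\<epsilon> > 0"
  obtain d where "d > 0" "\<And>D. packing T D \<Longrightarrow> (\<Sum>(u, v)\<in>D. v - u) < d \<Longrightarrow> (\<Sum>(u, v)\<in>D. norm (f v - f u)) < \<epsilon>"
    by (rule absolutely_continuous_onE[OF ac \<open>\<epsilon> > 0\<close>]) (rule that)
  then show "\<exists>\<delta>>0. \<forall>D. packing S D \<and> (\<Sum>(u, v)\<in>D. v - u) < \<delta> \<longrightarrow> (\<Sum>(u, v)\<in>D. norm (f v - f u)) < \<epsilon>"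
    using packing_subset[OF _ sub] by (intro exI[of _ d]) simp
qed

lemma absolutely_continuous_on_diff:
  assumes f: "absolutely_continuous_on S f" and g: "absolutely_continuous_on S g"
  shows "absolutely_continuous_on S (\<lambda>x. f x - g x)"
  unfolding absolutely_continuous_on_iff_packing
proof (intro allI impI)
  fix \<epsilon> :: real assume "\<epsilon> > 0"
  then have e: "\<epsilon>/2 > 0" by simp
  obtain d1 where d1: "d1 > 0" "\<And>D. packing S D \<Longrightarrow> (\<Sum>(u, v)\<in>D. v - u) < d1 \<Longrightarrow> (\<Sum>(u, v)\<in>D. norm (f v - f u)) < \<epsilon>/2"
    by (rule absolutely_continuous_onE[OF f e]) (rule that)
  obtain d2 where d2: "d2 > 0" "\<And>D. packing S D \<Longrightarrow> (\<Sum>(u, v)\<in>D. v - u) < d2 \<Longrightarrow> (\<Sum>(u, v)\<in>D. norm (g v - g u)) < \<epsilon>/2"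
    by (rule absolutely_continuous_onE[OF g e]) (rule that)
  have "(\<Sum>(u, v)\<in>D. norm (f v - g v - (f u - g u))) < \<epsilon>"
    if "packing S D" "(\<Sum>(u, v)\<in>D. v - u) < min d1 d2" for D
  proof -
    have "(\<Sum>(u, v)\<in>D. norm (f v - g v - (f u - g u))) 
       \<le> (\<Sum>(u, v)\<in>D. norm (f v - f u)) + (\<Sum>(u, v)\<in>D. norm (g v - g u))"
      unfolding sum.distrib[symmetric]
    proof (rule sum_mono, clarify)
      fix u v
      have "f v - g v - (f u - g u) = (f v - f u) - (g v - g u)" by simp
      then show "norm (f v - g v - (f u - g u)) \<le> norm (f v - f u) + norm (g v - g u)"
        by (metis norm_triangle_ineq4)
    qed
    then show ?thesis using d1(2)[of D] d2(2)[of D] that by simp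
  qed
  then show "\<exists>\<delta>>0. \<forall>D. packing S D \<and> (\<Sum>(u, v)\<in>D. v - u) < \<delta> \<longrightarrow> (\<Sum>(u, v)\<in>D. norm (f v - g v - (f u - g u))) < \<epsilon>"
    using d1(1) d2(1) by (intro exI[of _ "min d1 d2"]) simp
qed

text \<open>On intervals shorter than the \<open>\<delta>\<close> that belongs to \<open>\<epsilon> = 1\<close> all variations are at most \<open>1\<close>, so
  the decomposition into monotone functions applies. Bisection reduces \<open>{a..b}\<close> to such intervals.\<close>

lemma absolutely_continuous_has_density_real:
  fixes F :: "real \<Rightarrow> real"
  assumes "a \<le> b" and ac: "absolutely_continuous_on {a..b} F"
  shows "has_density_on a b F"
proof -
  obtain \<delta> where "\<delta> > 0" and \<delta>: "\<And>D. packing {a..b} D \<Longrightarrow> (\<Sum>(u, v)\<in>D. v - u) < \<delta>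
        \<Longrightarrow> (\<Sum>(u, v)\<in>D. norm (F v - F u)) < 1"
    by (rule absolutely_continuous_onE[OF ac zero_less_one]) (rule that)
  have short: "has_density_on x y F" if xy: "a \<le> x" "x \<le> y" "y \<le> b" "y - x < \<delta>" for x y
  proof -
    have sub: "{x..y} \<subseteq> {a..b}" using xy by auto
    have acs: "absolutely_continuous_on {x..y} F" by (rule absolutely_continuous_on_subset[OF ac sub])
    have "(\<Sum>(u, v)\<in>D. F v - F u) \<le> 1" if D: "packing {x..y} D" for D
    proof -
      have "(\<Sum>(u, v)\<in>D. v - u) \<le> measure lborel {x..y}" by (rule packing_length_le[OF D]) (simp_all add: emeasure_lborel_Icc_eq)
      then have "(\<Sum>(u, v)\<in>D. norm (F v - F u)) < 1"
        using xy by (intro \<delta> packing_subset[OF D sub]) simp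
      moreover have "(\<Sum>(u, v)\<in>D. F v - F u) \<le> (\<Sum>(u, v)\<in>D. norm (F v - F u))" by (rule sum_mono) auto
      ultimately show ?thesis by simp
    qed
    from positive_variation_decomposition[OF acs this]
    obtain P where P: "mono_on {x..y} P" "mono_on {x..y} (\<lambda>x. P x - F x)" "absolutely_continuous_on {x..y} P"
      by metis
    have "has_density_on x y P" by (rule mono_absolutely_continuous_has_density[OF \<open>x \<le> y\<close> P(1,3)])
    moreover have "has_density_on x y (\<lambda>x. P x - F x)"
      by (rule mono_absolutely_continuous_has_density[OF \<open>x \<le> y\<close> P(2) absolutely_continuous_on_diff[OF P(3) acs]])
    ultimately have "has_density_on x y (\<lambda>x. P x - (P x - F x))" by (rule has_density_on_diff)
    then show ?thesis by simp
  qed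
  have "a \<le> a \<and> b \<le> b \<longrightarrow> has_density_on a b F"
    using \<open>a \<le> b\<close>
  proof (induction rule: Bolzano[where P = "\<lambda>x y. a \<le> x \<and> y \<le> b \<longrightarrow> has_density_on x y F"])
    case (trans x y z)
    then show ?case using has_density_on_combine[of x y F z] by auto
  next
    case (local x)
    show ?case using short \<open>\<delta> > 0\<close> by (intro exI[of _ \<delta>]) auto
  qed
  then show ?thesis by simp
qed

lemma absolutely_continuous_on_dominated:
  assumes ac: "absolutely_continuous_on S f" and B: "\<And>u v. norm (g v - g u) \<le> norm (f v - f u)"
  shows "absolutely_continuous_on S g"
  unfolding absolutely_continuous_on_iff_packing
proof (intro allI impI)
  fix \<epsilon> :: real assume "\<epsilon> > 0"
  obtain d where d: "d > 0" "\<And>D. packing S D \<Longrightarrow> (\<Sum>(u, v)\<in>D. v - u) < d \<Longrightarrow> (\<Sum>(u, v)\<in>D. norm (f v - f u)) < \<epsilon>"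
    by (rule absolutely_continuous_onE[OF ac \<open>\<epsilon> > 0\<close>]) (rule that)
  have "(\<Sum>(u, v)\<in>D. norm (g v - g u)) \<le> (\<Sum>(u, v)\<in>D. norm (f v - f u))" for D
    by (rule sum_mono) (use B in auto)
  from le_less_trans[OF this d(2)]
  show "\<exists>\<delta>>0. \<forall>D. packing S D \<and> (\<Sum>(u, v)\<in>D. v - u) < \<delta> \<longrightarrow> (\<Sum>(u, v)\<in>D. norm (g v - g u)) < \<epsilon>"
    using d(1) by (intro exI[of _ d]) simp
qed

lemma absolutely_continuous_has_density:
  fixes F :: "real \<Rightarrow> complex"
  assumes "a \<le> b" and ac: "absolutely_continuous_on {a..b} F"
  shows "has_density_on a b F"
proof -
  have "absolutely_continuous_on {a..b} (\<lambda>x. Re (F x))" "absolutely_continuous_on {a..b} (\<lambda>x. Im (F x))"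
    by (rule absolutely_continuous_on_dominated[OF ac],
        metis abs_Re_le_cmod minus_complex.sel(1) real_norm_def,
        rule absolutely_continuous_on_dominated[OF ac],
        metis abs_Im_le_cmod minus_complex.sel(2) real_norm_def)
  from this[THEN absolutely_continuous_has_density_real[OF \<open>a \<le> b\<close>]]
  obtain f g where fg: "f absolutely_integrable_on {a..b}" "g absolutely_integrable_on {a..b}"
    "\<And>x. x \<in> {a..b} \<Longrightarrow> (f has_integral Re (F x) - Re (F a)) {a..x}" 
    "\<And>x. x \<in> {a..b} \<Longrightarrow> (g has_integral Im (F x) - Im (F a)) {a..x}"
    unfolding has_density_on_def by metis
  let ?h = "\<lambda>t. complex_of_real (f t) + \<i> * complex_of_real (g t)"
  have "?h absolutely_integrable_on {a..b}"
    using absolutely_integrable_linear[OF fg(1) bounded_linear_of_real]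
      absolutely_integrable_linear[OF fg(2) bounded_linear_of_real[THEN bounded_linear_const_mult[of _ \<i>]]]
    unfolding o_def by (rule set_integral_add(1))
  moreover have "(?h has_integral F x - F a) {a..x}" if "x \<in> {a..b}" for x
  proof -
    have "(?h has_integral of_real (Re (F x) - Re (F a)) + \<i> * of_real (Im (F x) - Im (F a))) {a..x}"
      using fg(3,4)[OF that] by (intro has_integral_add has_integral_mult_right has_integral_of_real)
    also have "of_real (Re (F x) - Re (F a)) + \<i> * of_real (Im (F x) - Im (F a)) = F x - F a"
      by (simp add: complex_eq_iff)
    finally show ?thesis .
  qed
  ultimately show ?thesis unfolding has_density_on_def by blast
qed

section \<open>Lebesgue differentiation and improper gauge integrals\<close>

text \<open>Almost everywhere the averages of the density over \<open>{x..x + k}\<close> converge to its value at \<open>x\<close>,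
  which gives right derivatives; the same fact for the reflected density gives left derivatives.\<close>

lemma has_density_on_has_vector_derivative:
  fixes F :: "real \<Rightarrow> 'a::euclidean_space"
  assumes g: "g absolutely_integrable_on {a..b}" and F: "\<And>x. x \<in> {a..b} \<Longrightarrow> (g has_integral F x - F a) {a..x}"
  obtains N where "negligible N" "\<And>t. t \<in> {a<..<b} - N \<Longrightarrow> (F has_vector_derivative g t) (at t)"
proof -
  have gi: "g integrable_on {a..b}" using g set_lebesgue_integral_eq_integral(1) by blast
  define h where "h t = (if t \<in> {a..b} then g t else 0)" for t
  have hU: "h integrable_on UNIV" unfolding h_def using gi by (simp only: integrable_restrict_UNIV)
  have h1: "h integrable_on cbox c d" for c d using integrable_on_subcbox[OF hU] by simp
  have h2: "(\<lambda>t. h (- t)) integrable_on cbox c d" for c d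
    using integrable_on_subcbox[OF hU, of "- d" "- c"] Henstock_Kurzweil_Integration.integrable_reflect_real[where f = h and a = "- d" and b = "- c"] by simp
  obtain N1 where N1: "negligible N1" "\<And>x e. \<lbrakk>x \<notin> N1; 0 < e\<rbrakk> \<Longrightarrow>
      \<exists>d>0. \<forall>k. 0 < k \<and> k < d \<longrightarrow> norm (integral (cbox x (x + k *\<^sub>R One)) h /\<^sub>R k ^ DIM(real) - h x) < e"
    using integrable_ccontinuous_explicit[OF h1] by metis
  obtain N2 where N2: "negligible N2" "\<And>x e. \<lbrakk>x \<notin> N2; 0 < e\<rbrakk> \<Longrightarrow>
      \<exists>d>0. \<forall>k. 0 < k \<and> k < d \<longrightarrow> norm (integral (cbox x (x + k *\<^sub>R One)) (\<lambda>t. h (- t)) /\<^sub>R k ^ DIM(real) - h (- x)) < e"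
    using integrable_ccontinuous_explicit[OF h2] by metis
  have inc: "integral {x..y} h = F y - F x" if "a \<le> x" "x \<le> y" "y \<le> b" for x y
  proof -
    have "integral {a..x} g + integral {x..y} g = integral {a..y} g"
      using that by (intro Henstock_Kurzweil_Integration.integral_combine integrable_on_subinterval[OF gi]) auto
    moreover have "integral {x..y} h = integral {x..y} g"
      by (rule integral_cong) (use that in \<open>auto simp: h_def\<close>)
    ultimately show ?thesis using F[of x] F[of y] that by (auto simp: integral_unique algebra_simps)
  qed
  show thesis
  proof
    have "negligible (uminus ` N2)"
      by (rule negligible_differentiable_image_negligible[OF _ N2(1)]) (auto intro!: derivative_intros)
    then show "negligible (N1 \<union> uminus ` N2)" using N1(1) by (rule negligible_Un[rotated])
    fix t assume t: "t \<in> {a<..<b} - (N1 \<union> uminus ` N2)"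
    then have "t \<notin> N1" "- t \<notin> N2" by force+
    have "\<exists>d>0. \<forall>y. norm (y - t) < d \<longrightarrow> norm (F y - F t - (y - t) *\<^sub>R g t) \<le> e * norm (y - t)" if "e > 0" for e :: real
    proof -
      obtain d1 where d1: "d1 > 0" "\<And>k. 0 < k \<Longrightarrow> k < d1 \<Longrightarrow> norm (integral {t..t + k} h /\<^sub>R k - h t) < e"
        using N1(2)[OF \<open>t \<notin> N1\<close> \<open>e > 0\<close>] by auto
      obtain d2 where d2: "d2 > 0" 
        "\<And>k. 0 < k \<Longrightarrow> k < d2 \<Longrightarrow> norm (integral {-t..-t + k} (\<lambda>t. h (- t)) /\<^sub>R k - h t) < e"
        using N2(2)[OF \<open>- t \<notin> N2\<close> \<open>e > 0\<close>] by auto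
      have ht: "h t = g t" using t by (auto simp: h_def)
      have scale: "norm (A - k *\<^sub>R B) \<le> e * k" if "norm (A /\<^sub>R k - B) < e" "k > 0" for A B :: 'a and k
      proof -
        have "A - k *\<^sub>R B = k *\<^sub>R (A /\<^sub>R k - B)"
          using \<open>k > 0\<close> by (simp add: scaleR_diff_right)
        then have "norm (A - k *\<^sub>R B) = k * norm (A /\<^sub>R k - B)" using \<open>k > 0\<close> by simp
        also have "\<dots> \<le> k * e" using that by (intro mult_left_mono) auto
        finally show ?thesis by (simp add: mult.commute)
      qed
      define d where "d = Min {d1, d2, t - a, b - t}"
      have d: "d > 0" "d \<le> d1" "d \<le> d2" "d \<le> t - a" "d \<le> b - t" using d1 d2 t by (auto simp: d_def)
      have "norm (F y - F t - (y - t) *\<^sub>R g t) \<le> e * norm (y - t)" if y: "norm (y - t) < d" for y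
      proof (cases y t rule: linorder_cases)
        case greater
        then have "norm (integral {t..t + (y - t)} h /\<^sub>R (y - t) - h t) < e"
          using y d by (intro d1(2)) auto
        moreover have "integral {t..t + (y - t)} h = F y - F t" using inc[of t y] greater y d t by auto
        ultimately show ?thesis using scale[where A = "F y - F t" and k = "y - t" and B = "g t"] greater by (simp add: ht)
      next
        case less
        then have "norm (integral {-t..-t + (t - y)} (\<lambda>t. h (- t)) /\<^sub>R (t - y) - h t) < e"
          using y d by (intro d2(2)) auto
        moreover have "integral {-t..-t + (t - y)} (\<lambda>t. h (- t)) = F t - F y" 
          using inc[of y t] less y d t Henstock_Kurzweil_Integration.integral_reflect_real[where f = h and a = y and b = t] by auto
        ultimately have "norm (F t - F y - (t - y) *\<^sub>R g t) \<le> e * (t - y)" 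
          using scale[where A = "F t - F y" and k = "t - y" and B = "g t"] less by (simp add: ht)
        moreover have "F t - F y - (t - y) *\<^sub>R g t = - (F y - F t - (y - t) *\<^sub>R g t)"
          by (simp add: algebra_simps)
        ultimately show ?thesis using less by (simp only: norm_minus_cancel) simp
      qed simp
      then show ?thesis using d(1) by blast
    qed
    then show "(F has_vector_derivative g t) (at t)"
      unfolding has_vector_derivative_def has_derivative_at_alt by (simp add: bounded_linear_scaleR_left)
  qed
qed

text \<open>Hake's theorem: improper gauge integrals are gauge integrals. Henstock's lemma on \<open>{c n..b}\<close> with
  error \<open>e / 4 * (1/2)^n\<close> provides a gauge for the tags \<open>x\<close> with \<open>m x = n\<close>, where \<open>c (m x) < x\<close>.
  Intervals tagged by such \<open>x\<close> are kept inside \<open>{c n<..}\<close>, so Henstock's lemma applies to them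
  and the errors sum up to at most \<open>e / 2\<close>. What remains is the interval tagged by \<open>a\<close>, which is made
  short.\<close>

theorem Hake_left:
  fixes f :: "real \<Rightarrow> 'a::euclidean_space"
  assumes "a < b" and int: "\<And>c. a < c \<Longrightarrow> c \<le> b \<Longrightarrow> f integrable_on {c..b}"
    and lim: "((\<lambda>c. integral {c..b} f) \<longlongrightarrow> L) (at_right a)"
  shows "(f has_integral L) {a..b}"
  unfolding has_integral_real
proof (intro allI impI)
  fix e :: real assume "e > 0"
  define c where "c n = a + (b - a) / real (Suc n)" for n
  have c: "a < c n" "c n \<le> b" for n
  proof -
    have "(b - a) / real (Suc n) \<le> (b - a) / 1" using \<open>a < b\<close> by (intro divide_left_mono) auto
    then show "c n \<le> b" by (simp add: c_def)
    show "a < c n" using \<open>a < b\<close> by (simp add: c_def)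
  qed
  have "\<exists>n. c n < x" if "a < x" for x
  proof -
    obtain n where "(b - a) / (x - a) < real n" using reals_Archimedean2 by blast
    then have "(b - a) / (x - a) < real (Suc n)" by simp
    then have "(b - a) / real (Suc n) < x - a" using that by (simp add: field_simps del: of_nat_Suc)
    then show ?thesis by (intro exI[of _ n]) (simp add: c_def)
  qed
  then obtain m where m: "\<And>x. a < x \<Longrightarrow> c (m x) < x" by metis
  define H where "H n g \<longleftrightarrow> gauge g \<and> (\<forall>p. p tagged_partial_division_of {c n..b} \<and> g fine p \<longrightarrow>
      (\<Sum>(x,k)\<in>p. norm (measure lborel k *\<^sub>R f x - integral k f)) < e / 4 * (1/2)^n)" for n g
  have "\<exists>g. H n g" for n
  proof -
    have 1: "f integrable_on cbox (c n) b" using int[OF c] by simp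
    have 2: "e / 4 * (1/2)^n > 0" using \<open>e > 0\<close> by simp
    obtain g where g: "gauge g" "\<And>p. \<lbrakk>p tagged_partial_division_of cbox (c n) b; g fine p\<rbrakk> \<Longrightarrow>
             (\<Sum>(x,k)\<in>p. norm (measure lborel k *\<^sub>R f x - integral k f)) < e / 4 * (1/2)^n"
      by (rule Henstock_lemma[OF 1 2]) (rule that)
    show ?thesis unfolding H_def by (rule exI[of _ g]) (use g in simp)
  qed
  then obtain \<gamma> where "\<And>n. H n (\<gamma> n)" by metis
  then have \<gamma>: "\<And>n. gauge (\<gamma> n)" 
    "\<And>n p. p tagged_partial_division_of {c n..b} \<Longrightarrow> \<gamma> n fine p \<Longrightarrow>
      (\<Sum>(x,k)\<in>p. norm (measure lborel k *\<^sub>R f x - integral k f)) < e / 4 * (1/2)^n"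
    unfolding H_def by simp_all
  have "\<forall>\<^sub>F y in at_right a. dist (integral {y..b} f) L < e / 4"
    using lim \<open>e > 0\<close> by (intro tendstoD) auto
  then obtain y0 where y0: "y0 > a" "\<And>y. a < y \<Longrightarrow> y < y0 \<Longrightarrow> dist (integral {y..b} f) L < e / 4"
    unfolding eventually_at_right_field by blast
  define \<delta> where "\<delta> = min (y0 - a) (e / (4 * (norm (f a) + 1)))"
  have "\<delta> > 0" using y0(1) \<open>e > 0\<close> by (simp add: \<delta>_def divide_pos_pos add_nonneg_pos)
  have \<delta>a: "\<delta> * norm (f a) \<le> e / 4"
  proof -
    have eX: "e / (4 * X) * X = e / 4" if "X > 0" for X :: real using that by simp
    have "e / (4 * (norm (f a) + 1)) * (norm (f a) + 1) = e / 4" by (rule eX) (simp add: add_nonneg_pos)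
    have "\<delta> * norm (f a) \<le> e / (4 * (norm (f a) + 1)) * (norm (f a) + 1)"
      using \<open>e > 0\<close> by (intro mult_mono) (auto simp: \<delta>_def)
    also note \<open>e / (4 * (norm (f a) + 1)) * (norm (f a) + 1) = e / 4\<close>
    finally show ?thesis .
  qed
  define G where "G x = (if x \<le> a then ball x \<delta> else \<gamma> (m x) x \<inter> {c (m x)<..})" for x
  have "gauge G"
    unfolding gauge_def G_def using \<gamma>(1) m \<open>\<delta> > 0\<close> by (auto simp: gauge_def)
  moreover have "norm (sum (\<lambda>(x,k). measure lborel k *\<^sub>R f x) p - L) < e" if p: "p tagged_division_of {a..b}" "G fine p" for p
  proof -
    note pD = tagged_division_ofD[OF p(1)]
    \<comment> \<open>\<open>F\<close> is the tail integral, continuous at \<open>a\<close>; its increments telescope to \<open>L\<close>.\<close>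
    define F where "F y = (if y \<le> a then L else integral {y..b} f)" for y
    define T where "T = (\<lambda>(x,k). measure lborel k *\<^sub>R f x - (F (Inf k) - F (Sup k)))"
    have K: "k = {Inf k..Sup k}" "Inf k \<le> Sup k" "a \<le> Inf k" "Sup k \<le> b" "Inf k \<le> x" "x \<le> Sup k"
      if "(x,k) \<in> p" for x k
    proof -
      obtain u v where uv: "k = {u..v}" using pD(4)[OF \<open>(x,k) \<in> p\<close>] by auto
      then have "u \<le> x" "x \<le> v" using pD(2)[OF \<open>(x,k) \<in> p\<close>] by auto
      moreover have "a \<le> u" "v \<le> b" using pD(3)[OF \<open>(x,k) \<in> p\<close>] uv calculation by auto
      moreover have "Inf k = u" "Sup k = v" using uv calculation(1,2) by auto
      ultimately show "k = {Inf k..Sup k}" "Inf k \<le> Sup k" "a \<le> Inf k" "Sup k \<le> b" "Inf k \<le> x" "x \<le> Sup k"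
        using uv by auto
    qed
    have fine: "k \<subseteq> G x" if "(x,k) \<in> p" for x k using p(2) that by (auto simp: fine_def)
    have "F b = 0" "F a = L" using \<open>a < b\<close> by (auto simp: F_def)
    then have "L = (\<Sum>(x,k)\<in>p. F (Inf k) - F (Sup k))"
      using additive_tagged_division_1[OF less_imp_le[OF \<open>a < b\<close>] p(1), of "\<lambda>x. - F x"] by simp
    then have eq: "(\<Sum>(x,k)\<in>p. measure lborel k *\<^sub>R f x) - L = sum T p"
      by (simp add: T_def split_def sum_subtractf)
    define p0 where "p0 = {q\<in>p. fst q = a}"
    define p1 where "p1 = {q\<in>p. a < fst q}"
    have "p = p0 \<union> p1" "p0 \<inter> p1 = {}"
      unfolding p0_def p1_def using K(3,5) by (force simp: less_le)+
    then have split: "sum T p = sum T p0 + sum T p1" using pD(1) by (metis finite_Un sum.union_disjoint)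
    \<comment> \<open>At most one interval tagged by \<open>a\<close> has positive length; \<open>{a}\<close> itself contributes \<open>0\<close>.\<close>
    have "norm (sum T p0) < e / 2"
    proof (cases "\<exists>q\<in>p0. a < Sup (snd q)")
      case False
      have "T q = 0" if "q \<in> p0" for q
      proof -
        define k where "k = snd q"
        have k: "q = (a,k)" "(a,k) \<in> p" using that by (auto simp: p0_def k_def)
        then have "Sup k \<le> a" using False that by auto
        then have ik: "Inf k = a" "Sup k = a" using K[OF k(2)] by auto
        then have "measure lborel k = 0" using arg_cong[OF K(1)[OF k(2)], of "measure lborel"] by simp
        then show ?thesis using ik by (simp add: T_def k)
      qed
      then have "sum T p0 = 0" by (intro sum.neutral) blast
      then show ?thesis using \<open>e > 0\<close> by simp
    next
      case True
      then obtain k where k: "(a,k) \<in> p" "a < Sup k" "(a,k) \<in> p0" by (auto simp: p0_def)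
      have Ik: "Inf k = a" using K(3,5)[OF k(1)] by simp
      then have ik: "k = {a..Sup k}" using K(1)[OF k(1)] by simp
      have mk: "measure lborel k = Sup k - a" using arg_cong[OF ik, of "measure lborel"] k(2) by simp
      have "Sup k \<in> k" by (subst (2) ik) (use k(2) in simp)
      then have "Sup k \<in> ball a \<delta>" using fine[OF k(1)] by (auto simp: G_def)
      then have small: "Sup k - a < \<delta>" using k(2) by (auto simp: dist_real_def)
      have T0: "T q = 0" if q: "q \<in> p0 - {(a,k)}" for q
      proof -
        define l where "l = snd q"
        have l: "q = (a,l)" "(a,l) \<in> p" using q by (auto simp: p0_def l_def)
        then have "l \<noteq> k" using q by auto
        have il: "Inf l = a" "l = {a..Sup l}" using K[OF l(2)] by auto
        have "interior k \<inter> interior l = {}" using pD(5)[OF k(1) l(2)] \<open>l \<noteq> k\<close> by auto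
        then have "{a<..<Sup k} \<inter> {a<..<Sup l} = {}"
          by (subst (asm) ik, subst (asm) il(2)) simp
        moreover have "(a + min (Sup k) (Sup l)) / 2 \<in> {a<..<Sup k} \<inter> {a<..<Sup l}" if "a < Sup l"
          using that k(2) by (auto simp: min_def)
        ultimately have "\<not> a < Sup l" by blast
        then have sl: "Sup l = a" using K[OF l(2)] by auto
        then have "measure lborel l = 0" using arg_cong[OF il(2), of "measure lborel"] by simp
        then show ?thesis using il(1) sl by (simp add: T_def l)
      qed
      have "sum T p0 = T (a,k) + sum T (p0 - {(a,k)})"
        using pD(1) k(3) by (intro sum.remove) (simp_all add: p0_def)
      also have "sum T (p0 - {(a,k)}) = 0" by (rule sum.neutral) (use T0 in blast)
      also have "T (a,k) = (Sup k - a) *\<^sub>R f a - (L - integral {Sup k..b} f)"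
        using Ik mk k(2) by (simp add: T_def F_def)
      finally have "norm (sum T p0) \<le> norm ((Sup k - a) *\<^sub>R f a) + norm (L - integral {Sup k..b} f)"
        by (simp only: add_0_right norm_triangle_ineq4)
      also have "norm ((Sup k - a) *\<^sub>R f a) \<le> \<delta> * norm (f a)"
        using k(2) small by (auto intro!: mult_right_mono)
      also note \<delta>a
      also have "norm (L - integral {Sup k..b} f) < e / 4"
        using y0(2)[of "Sup k"] small k(2) by (simp add: \<delta>_def dist_norm norm_minus_commute)
      finally show ?thesis by simp
    qed
    moreover have "norm (sum T p1) \<le> e / 2"
    proof -
      have fin: "finite p1" using pD(1) by (simp add: p1_def)
      define M where "M = (\<lambda>q. m (fst q)) ` p1"
      have "sum T p1 = (\<Sum>n\<in>M. \<Sum>q\<in>{q\<in>p1. m (fst q) = n}. T q)"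
        unfolding M_def using fin by (intro sum.group[symmetric]) auto
      also have "norm \<dots> \<le> (\<Sum>n\<in>M. e / 4 * (1/2)^n)"
      proof (rule sum_norm_le)
        fix n assume "n \<in> M"
        let ?p = "{q\<in>p1. m (fst q) = n}"
        have inn: "k \<subseteq> {c n..b}" "k \<subseteq> \<gamma> n x" "T (x,k) = measure lborel k *\<^sub>R f x - integral k f" if "(x,k) \<in> ?p" for x k
        proof -
          have q: "(x,k) \<in> p" "a < x" "m x = n" using that by (auto simp: p1_def)
          then have kk: "k \<subseteq> \<gamma> n x" "k \<subseteq> {c n<..}" using fine[OF q(1)] by (auto simp: G_def)
          have "Inf k \<in> k" by (subst (2) K(1)[OF q(1)]) (use K(2)[OF q(1)] in simp)
          then have "Inf k \<in> {c n<..}" using kk(2) by blast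
          then have "a < Inf k" using c(1)[of n] by auto
          have "integral {Inf k..Sup k} f + integral {Sup k..b} f = integral {Inf k..b} f"
            using K(2,4)[OF q(1)] \<open>a < Inf k\<close> by (intro Henstock_Kurzweil_Integration.integral_combine int) auto
          moreover have "integral k f = integral {Inf k..Sup k} f" by (rule arg_cong[OF K(1)[OF q(1)]])
          ultimately show "T (x,k) = measure lborel k *\<^sub>R f x - integral k f"
            using \<open>a < Inf k\<close> K(2)[OF q(1)] by (simp add: T_def F_def algebra_simps)
          show "k \<subseteq> \<gamma> n x" by (rule kk)
          show "k \<subseteq> {c n..b}" using kk(2) pD(3)[OF q(1)] by fastforce
        qed
        have part: "?p tagged_partial_division_of {c n..b}"
          unfolding tagged_partial_division_of_def
        proof (intro conjI allI impI)
          show "finite ?p" using fin by simp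
          fix x k assume xk: "(x,k) \<in> ?p"
          then have "(x,k) \<in> p" by (simp add: p1_def)
          then show "x \<in> k" "\<exists>a b. k = cbox a b" using pD(2,4) by blast+
          show "k \<subseteq> {c n..b}" by (rule inn(1)[OF xk])
        next
          fix x1 K1 x2 K2 assume "(x1, K1) \<in> ?p \<and> (x2, K2) \<in> ?p \<and> (x1, K1) \<noteq> (x2, K2)"
          then show "interior K1 \<inter> interior K2 = {}" using pD(5)[of x1 K1 x2 K2] by (auto simp: p1_def)
        qed
        have "norm (sum T ?p) \<le> (\<Sum>q\<in>?p. norm (T q))" by (rule norm_sum)
        also have "\<dots> = (\<Sum>(x,k)\<in>?p. norm (measure lborel k *\<^sub>R f x - integral k f))"
          by (rule sum.cong[OF refl]) (use inn(3) in force)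
        also have "\<dots> < e / 4 * (1/2)^n"
          by (rule \<gamma>(2)[OF part]) (use inn(2) in \<open>force simp: fine_def\<close>)
        finally show "norm (sum T ?p) \<le> e / 4 * (1/2)^n" by simp
      qed
      also have "\<dots> = e / 4 * (\<Sum>n\<in>M. (1/2)^n)" by (simp add: sum_distrib_left)
      also have "(\<Sum>n\<in>M. (1/2::real)^n) \<le> (\<Sum>n. (1/2)^n)"
        using fin by (intro sum_le_suminf summable_geometric) (auto simp: M_def)
      also have "(\<Sum>n. (1/2::real)^n) = 2" by (simp add: suminf_geometric)
      finally show ?thesis using \<open>e > 0\<close> by simp
    qed
    ultimately have "norm (sum T p0 + sum T p1) < e" using norm_triangle_ineq[of "sum T p0" "sum T p1"] by simp
    then show ?thesis using eq split by simp
  qed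
  ultimately show "\<exists>\<gamma>. gauge \<gamma> \<and> (\<forall>p. p tagged_division_of {a..b} \<and> \<gamma> fine p \<longrightarrow>
        norm (sum (\<lambda>(x,k). measure lborel k *\<^sub>R f x) p - L) < e)"
    by (intro exI[of _ G]) simp
qed

section \<open>The weighted derivative\<close>

lemma absolutely_continuous_on_times_id:
  fixes f :: "real \<Rightarrow> 'a::euclidean_space"
  assumes ac: "absolutely_continuous_on {a..b} f" and "0 < a" "a \<le> b"
  shows "absolutely_continuous_on {a..b} (\<lambda>t. t *\<^sub>R f t)"
  unfolding absolutely_continuous_on_iff_packing
proof (intro allI impI)
  fix \<epsilon> :: real assume "\<epsilon> > 0"
  have "compact (f ` {a..b})"
    using absolutely_continuous_on_imp_continuous_on[OF ac] by (intro compact_continuous_image) auto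
  then obtain M where M: "M > 0" "\<And>t. t \<in> {a..b} \<Longrightarrow> norm (f t) \<le> M"
    using compact_imp_bounded bounded_pos by (metis imageI)
  have "b > 0" using assms(2,3) by simp
  then have e: "\<epsilon> / (2 * b) > 0" using \<open>\<epsilon> > 0\<close> by simp
  obtain d where d: "d > 0" "\<And>D. packing {a..b} D \<Longrightarrow> (\<Sum>(u, v)\<in>D. v - u) < d \<Longrightarrow> (\<Sum>(u, v)\<in>D. norm (f v - f u)) < \<epsilon> / (2 * b)"
    by (rule absolutely_continuous_onE[OF ac e]) (rule that)
  define \<delta> where "\<delta> = min d (\<epsilon> / (2 * M))"
  have "(\<Sum>(u, v)\<in>D. norm (v *\<^sub>R f v - u *\<^sub>R f u)) < \<epsilon>"
    if D: "packing {a..b} D" "(\<Sum>(u, v)\<in>D. v - u) < \<delta>" for D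
  proof -
    have "norm (v *\<^sub>R f v - u *\<^sub>R f u) \<le> b * norm (f v - f u) + M * (v - u)" if "(u,v) \<in> D" for u v
    proof -
      have uv: "u < v" "u \<in> {a..b}" "v \<in> {a..b}" using D(1) that by (auto simp: packing_def)
      have "v *\<^sub>R f v - u *\<^sub>R f u = v *\<^sub>R (f v - f u) + (v - u) *\<^sub>R f u" by (simp add: algebra_simps)
      then have "norm (v *\<^sub>R f v - u *\<^sub>R f u) \<le> norm (v *\<^sub>R (f v - f u)) + norm ((v - u) *\<^sub>R f u)"
        using norm_triangle_ineq by metis
      also have "norm (v *\<^sub>R (f v - f u)) \<le> b * norm (f v - f u)"
        using uv \<open>0 < a\<close> by (auto intro!: mult_right_mono)
      also have "norm ((v - u) *\<^sub>R f u) \<le> M * (v - u)"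
        using uv(1) M(2)[OF uv(2)] by (simp add: mult.commute mult_left_mono)
      finally show ?thesis by simp
    qed
    then have "(\<Sum>(u, v)\<in>D. norm (v *\<^sub>R f v - u *\<^sub>R f u)) \<le> (\<Sum>(u, v)\<in>D. b * norm (f v - f u) + M * (v - u))"
      by (intro sum_mono) auto
    also have "\<dots> = b * (\<Sum>(u, v)\<in>D. norm (f v - f u)) + M * (\<Sum>(u, v)\<in>D. v - u)"
      by (simp add: split_def sum.distrib sum_distrib_left)
    also have "b * (\<Sum>(u, v)\<in>D. norm (f v - f u)) < b * (\<epsilon> / (2 * b))"
      using \<open>b > 0\<close> D by (intro mult_strict_left_mono d(2)) (auto simp: \<delta>_def)
    also have "M * (\<Sum>(u, v)\<in>D. v - u) < M * (\<epsilon> / (2 * M))"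
      using M(1) D(2) by (intro mult_strict_left_mono) (auto simp: \<delta>_def)
    finally show ?thesis using M(1) \<open>b > 0\<close> by simp
  qed
  moreover have "\<delta> > 0" using d(1) M(1) \<open>\<epsilon> > 0\<close> by (simp add: \<delta>_def)
  ultimately show "\<exists>\<delta>>0. \<forall>D. packing {a..b} D \<and> (\<Sum>(u, v)\<in>D. v - u) < \<delta> \<longrightarrow> (\<Sum>(u, v)\<in>D. norm (v *\<^sub>R f v - u *\<^sub>R f u)) < \<epsilon>"
    by (intro exI[of _ \<delta>]) simp
qed

text \<open>The fundamental theorem of calculus is applied to \<open>h t = t *\<^sub>R f t\<close> instead of \<open>f\<close>, which makes an
  integration by parts superfluous: almost everywhere \<open>h' t = f t + t *\<^sub>R f' t\<close>, and \<open>f' t\<close> exists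
  wherever \<open>h' t\<close> does because \<open>t > 0\<close>.\<close>

lemma weighted_derivative_integral:
  fixes f :: "real \<Rightarrow> complex"
  assumes ac: "absolutely_continuous_on {a..b} f" and ab: "0 < a" "a \<le> b"
  shows "(\<lambda>t. t *\<^sub>R vector_derivative f (at t)) absolutely_integrable_on {a..b}"
    and "((\<lambda>t. t *\<^sub>R vector_derivative f (at t)) has_integral b *\<^sub>R f b - a *\<^sub>R f a - integral {a..b} f) {a..b}"
proof -
  have cont: "continuous_on {a..b} f" using absolutely_continuous_on_imp_continuous_on[OF ac] by simp
  then have fi: "f absolutely_integrable_on {a..b}" by (rule absolutely_integrable_continuous_real)
  define h where "h t = t *\<^sub>R f t" for t
  have "has_density_on a b h"
    unfolding h_def by (intro absolutely_continuous_has_density absolutely_continuous_on_times_id ac ab)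
  then obtain g where g: "g absolutely_integrable_on {a..b}" "\<And>x. x \<in> {a..b} \<Longrightarrow> (g has_integral h x - h a) {a..x}"
    unfolding has_density_on_def by metis
  obtain N where N: "negligible N" "\<And>t. t \<in> {a<..<b} - N \<Longrightarrow> (h has_vector_derivative g t) (at t)"
    by (rule has_density_on_has_vector_derivative[OF g]) (assumption, rule that)
  have eq: "t *\<^sub>R vector_derivative f (at t) = g t - f t" if t: "t \<in> {a..b} - (N \<union> {a,b})" for t
  proof -
    have "t > 0" using t ab by auto
    have "((\<lambda>s. inverse s *\<^sub>R h s) has_vector_derivative (inverse t *\<^sub>R g t + (- (inverse t * inverse t)) *\<^sub>R h t)) (at t)"
      using N(2)[of t] t \<open>t > 0\<close>
      by (intro has_vector_derivative_scaleR) (auto intro!: derivative_eq_intros simp: power2_eq_square)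
    then have "(f has_vector_derivative (inverse t *\<^sub>R g t + (- (inverse t * inverse t)) *\<^sub>R h t)) (at t)"
      by (rule has_vector_derivative_transform_within_open[of _ _ _ "{0<..}"]) (use \<open>t > 0\<close> in \<open>auto simp: h_def\<close>)
    then have "vector_derivative f (at t) = inverse t *\<^sub>R g t + (- (inverse t * inverse t)) *\<^sub>R h t"
      by (rule vector_derivative_at)
    moreover have "t * (inverse t * inverse t * t) = 1" using \<open>t > 0\<close> by (simp add: field_simps)
    ultimately show ?thesis using \<open>t > 0\<close> by (simp add: h_def scaleR_diff_right)
  qed
  have neg: "negligible (N \<union> {a,b})" using N(1) by simp
  show "(\<lambda>t. t *\<^sub>R vector_derivative f (at t)) absolutely_integrable_on {a..b}"
    by (rule absolutely_integrable_spike[OF set_integral_diff(1)[OF g(1) fi] neg]) (use eq in simp)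
  have "((\<lambda>t. g t - f t) has_integral (h b - h a) - integral {a..b} f) {a..b}"
    using g(2)[of b] ab(2) fi by (intro has_integral_diff integrable_integral) (auto intro: set_lebesgue_integral_eq_integral(1))
  then have "((\<lambda>t. g t - f t) has_integral b *\<^sub>R f b - a *\<^sub>R f a - integral {a..b} f) {a..b}"
    by (simp add: h_def)
  from has_integral_spike[OF neg eq this]
  show "((\<lambda>t. t *\<^sub>R vector_derivative f (at t)) has_integral b *\<^sub>R f b - a *\<^sub>R f a - integral {a..b} f) {a..b}" .
qed

text \<open>At the left endpoint \<open>0\<close> only gauge integrability can be expected; it follows from Hake's
  theorem because \<open>f\<close> is continuous at \<open>0\<close>.\<close>

lemma weighted_derivative_integral_nonneg:
  fixes f :: "real \<Rightarrow> complex"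
  assumes cont: "continuous_on {0..} f" and ac: "AC_loc f" and A: "0 \<le> A" "A < T"
  shows "((\<lambda>t. t *\<^sub>R vector_derivative f (at t)) has_integral T *\<^sub>R f T - A *\<^sub>R f A - integral {A..T} f) {A..T}"
proof -
  have pos: "((\<lambda>t. t *\<^sub>R vector_derivative f (at t)) has_integral T *\<^sub>R f T - c *\<^sub>R f c - integral {c..T} f) {c..T}" 
    if "0 < c" "c < T" for c
    using ac that by (intro weighted_derivative_integral(2)) (auto simp: AC_loc_def)
  show ?thesis
  proof (cases "A = 0")
    case False then show ?thesis using pos[of A] A by simp
  next
    case True
    then have "0 < T" using A by simp
    have c0: "continuous_on {0..T} f" using cont by (rule continuous_on_subset) auto
    have fin: "f integrable_on {0..T}" using c0 by (rule integrable_continuous_real)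
    have "((\<lambda>t. t *\<^sub>R vector_derivative f (at t)) has_integral T *\<^sub>R f T - 0 *\<^sub>R f 0 - integral {0..T} f) {0..T}"
    proof (rule Hake_left[OF \<open>0 < T\<close>])
      show "(\<lambda>t. t *\<^sub>R vector_derivative f (at t)) integrable_on {c..T}" if "0 < c" "c \<le> T" for c
      proof (cases "c = T")
        case True
        then show ?thesis by (metis box_real(2) integrable_on_refl)
      qed (use pos[of c] that in \<open>auto simp: has_integral_integrable\<close>)
      have "continuous_on {0..T} (\<lambda>c. T *\<^sub>R f T - c *\<^sub>R f c - integral {c..T} f)"
        using c0 fin by (intro continuous_intros indefinite_integral_continuous_1')
      then have "((\<lambda>c. T *\<^sub>R f T - c *\<^sub>R f c - integral {c..T} f) \<longlongrightarrow> T *\<^sub>R f T - 0 *\<^sub>R f 0 - integral {0..T} f) (at 0 within {0..T})"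
        unfolding continuous_on_def by (rule bspec) (use \<open>0 < T\<close> in simp)
      then have "((\<lambda>c. T *\<^sub>R f T - c *\<^sub>R f c - integral {c..T} f) \<longlongrightarrow> T *\<^sub>R f T - 0 *\<^sub>R f 0 - integral {0..T} f) (at_right 0)"
        using \<open>0 < T\<close> by (simp add: at_within_Icc_at_right)
      moreover have "\<forall>\<^sub>F c in at_right 0. T *\<^sub>R f T - c *\<^sub>R f c - integral {c..T} f = integral {c..T} (\<lambda>t. t *\<^sub>R vector_derivative f (at t))"
        using eventually_at_right_real[OF \<open>0 < T\<close>] by eventually_elim (rule integral_unique[OF pos, symmetric], auto)
      ultimately show "((\<lambda>c. integral {c..T} (\<lambda>t. t *\<^sub>R vector_derivative f (at t))) \<longlongrightarrow> T *\<^sub>R f T - 0 *\<^sub>R f 0 - integral {0..T} f) (at_right 0)"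
        by (rule Lim_transform_eventually)
    qed
    then show ?thesis using True by simp
  qed
qed

section \<open>Radial functions of the maximum norm\<close>

lemma even_integral:
  fixes h :: "real \<Rightarrow> 'a::{banach, second_countable_topology}"
  assumes h: "set_integrable lborel {0..} h"
  shows "integrable lborel (\<lambda>x. h \<bar>x\<bar>)" "(LINT x|lborel. h \<bar>x\<bar>) = 2 *\<^sub>R (LINT x:{0..}|lborel. h x)"
proof -
  define k where "k x = indicator {0..} x *\<^sub>R h x" for x
  have k: "integrable lborel k" using h by (simp add: set_integrable_def k_def[abs_def])
  have k': "integrable lborel (\<lambda>x. k (- x))" using lborel_integrable_real_affine[OF k, of "-1" 0] by simp
  have ae: "AE x in lborel. h \<bar>x\<bar> = k x + k (- x)"
    using AE_lborel_singleton[of "0::real"] by eventually_elim (auto simp: k_def indicator_def)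
  have "(\<lambda>x. h \<bar>x\<bar>) = (\<lambda>x. k \<bar>x\<bar>)" by (auto simp: k_def)
  then have meas: "(\<lambda>x. h \<bar>x\<bar>) \<in> borel_measurable lborel" using k by (auto intro: measurable_compose[of abs])
  show "integrable lborel (\<lambda>x. h \<bar>x\<bar>)"
    using ae k k' meas by (subst integrable_cong_AE[OF _ _ ae]) auto
  have "(LINT x|lborel. h \<bar>x\<bar>) = (LINT x|lborel. k x + k (- x))"
    using k k' by (intro integral_cong_AE meas ae) auto
  also have "\<dots> = (LINT x|lborel. k x) + (LINT x|lborel. k (- x))" using k k' by (rule Bochner_Integration.integral_add)
  also have "(LINT x|lborel. k (- x)) = (LINT x|lborel. k x)"
    using lborel_integral_real_affine[of "-1" k 0] by simp
  finally show "(LINT x|lborel. h \<bar>x\<bar>) = 2 *\<^sub>R (LINT x:{0..}|lborel. h x)"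
    by (simp add: set_lebesgue_integral_def k_def scaleR_2)
qed

text \<open>The integrand is constant on \<open>{0..<a}\<close>.\<close>

lemma companion_eq_integral_max:
  fixes f :: "real \<Rightarrow> 'a::{banach, second_countable_topology}"
  assumes f: "set_integrable lborel {0..} f" and "0 \<le> a"
  shows "set_integrable lborel {0..} (\<lambda>t. f (max a t))"
    and "(LINT t:{0..}|lborel. f (max a t)) = a *\<^sub>R f a + (LINT t:{a..}|lborel. f t)"
proof -
  have split: "{0..} = {0..<a} \<union> {a..}" using \<open>0 \<le> a\<close> by auto
  have "set_integrable lborel {a..} f" by (rule set_integrable_subset[OF f]) (use \<open>0 \<le> a\<close> in auto)
  moreover have "set_integrable lborel {a..} (\<lambda>t. f (max a t)) = set_integrable lborel {a..} f"
    by (rule set_integrable_cong) auto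
  ultimately have 2: "set_integrable lborel {a..} (\<lambda>t. f (max a t))" by simp
  have "set_integrable lborel {0..<a} (\<lambda>t. f a)"
    using \<open>0 \<le> a\<close> by (simp add: set_integrable_def)
  moreover have "set_integrable lborel {0..<a} (\<lambda>t. f (max a t)) = set_integrable lborel {0..<a} (\<lambda>t. f a)"
    by (rule set_integrable_cong) auto
  ultimately have 1: "set_integrable lborel {0..<a} (\<lambda>t. f (max a t))" by simp
  show "set_integrable lborel {0..} (\<lambda>t. f (max a t))"
    unfolding split using 1 2 by (rule set_integrable_Un) auto
  have "(LINT t:{0..}|lborel. f (max a t)) = (LINT t:{0..<a}|lborel. f (max a t)) + (LINT t:{a..}|lborel. f (max a t))"
    unfolding split using 1 2 by (intro set_integral_Un) auto
  also have "(LINT t:{0..<a}|lborel. f (max a t)) = (LINT t:{0..<a}|lborel. f a)"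
    by (rule set_lebesgue_integral_cong) auto
  also have "\<dots> = a *\<^sub>R f a" using \<open>0 \<le> a\<close> by (simp add: set_lebesgue_integral_def)
  also have "(LINT t:{a..}|lborel. f (max a t)) = (LINT t:{a..}|lborel. f t)"
    by (rule set_lebesgue_integral_cong) auto
  finally show "(LINT t:{0..}|lborel. f (max a t)) = a *\<^sub>R f a + (LINT t:{a..}|lborel. f t)" .
qed

text \<open>The key identity: integrating out one variable turns the radial function of the maximum norm into
  twice its companion.\<close>

lemma max_fun_section:
  fixes f :: "real \<Rightarrow> complex"
  assumes f: "set_integrable lborel {0..} f"
  shows "(LINT y|lborel. max_fun f (x, y)) = 2 *\<^sub>R companion f x"
  unfolding max_fun_def companion_def prod.case
  by (subst even_integral(2)[OF companion_eq_integral_max(1)[OF f]])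
    (simp_all add: companion_eq_integral_max(2)[OF f])

text \<open>By symmetry it suffices to integrate over the double cone \<open>\<bar>y\<bar> \<le> \<bar>x\<bar>\<close>, where the function is \<open>f \<bar>x\<bar>\<close>
  and the section over \<open>x\<close> has length \<open>2 * \<bar>x\<bar>\<close>.\<close>

lemma integrable_max_fun:
  fixes f :: "real \<Rightarrow> complex"
  assumes cont: "continuous_on {0..} f" and int: "set_integrable lborel {0..} (\<lambda>t. t * norm (f t))"
  shows "integrable (lborel \<Otimes>\<^sub>M lborel) (max_fun f)"
proof -
  have cm: "continuous_on UNIV (\<lambda>p::real \<times> real. f (max \<bar>fst p\<bar> \<bar>snd p\<bar>))"
    by (intro continuous_on_compose2[OF cont] continuous_intros) auto
  have meas: "max_fun f \<in> borel_measurable (lborel \<Otimes>\<^sub>M lborel)"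
    unfolding lborel_prod max_fun_def split_def using borel_measurable_continuous_onI[OF cm] by simp
  have "continuous_on UNIV (\<lambda>x. f \<bar>x\<bar>)"
    by (intro continuous_on_compose2[OF cont] continuous_intros) auto
  then have [measurable]: "(\<lambda>x. f \<bar>x\<bar>) \<in> borel_measurable borel" by (rule borel_measurable_continuous_onI)
  define u where "u = (\<lambda>(x::real, y::real). ennreal (norm (f \<bar>x\<bar>)) * indicator {p. \<bar>snd p\<bar> \<le> \<bar>fst p\<bar>} (x, y))"
  have [measurable]: "{p::real \<times> real. \<bar>snd p\<bar> \<le> \<bar>fst p\<bar>} \<in> sets (lborel \<Otimes>\<^sub>M lborel)"
    unfolding lborel_prod sets_lborel by (intro borel_closed closed_Collect_le continuous_intros)
  have um[measurable]: "u \<in> borel_measurable (lborel \<Otimes>\<^sub>M lborel)" unfolding u_def by measurable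
  have us[measurable]: "(\<lambda>p. u (snd p, fst p)) \<in> borel_measurable (lborel \<Otimes>\<^sub>M lborel)" by measurable
  have "(\<integral>\<^sup>+p. u p \<partial>(lborel \<Otimes>\<^sub>M lborel)) = (\<integral>\<^sup>+x. \<integral>\<^sup>+y. u (x, y) \<partial>lborel \<partial>lborel)"
    by (rule lborel.nn_integral_fst[symmetric, OF um])
  also have "\<dots> = (\<integral>\<^sup>+x. ennreal (norm (2 * (\<bar>x\<bar> * norm (f \<bar>x\<bar>)))) \<partial>lborel)"
  proof (rule nn_integral_cong)
    fix x :: real
    have "(\<integral>\<^sup>+y. u (x, y) \<partial>lborel) = (\<integral>\<^sup>+y. ennreal (norm (f \<bar>x\<bar>)) * indicator {- \<bar>x\<bar>..\<bar>x\<bar>} y \<partial>lborel)"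
      by (rule nn_integral_cong) (auto simp: u_def indicator_def)
    also have "\<dots> = ennreal (norm (f \<bar>x\<bar>)) * emeasure lborel {- \<bar>x\<bar>..\<bar>x\<bar>}"
      by (rule nn_integral_cmult_indicator) simp
    also have "\<dots> = ennreal (norm (2 * (\<bar>x\<bar> * norm (f \<bar>x\<bar>))))"
      by (simp add: ennreal_mult[symmetric] mult_ac abs_mult)
    finally show "(\<integral>\<^sup>+y. u (x, y) \<partial>lborel) = ennreal (norm (2 * (\<bar>x\<bar> * norm (f \<bar>x\<bar>))))" .
  qed
  also have "\<dots> < \<infinity>"
  proof -
    have "integrable lborel (\<lambda>x. 2 * (\<bar>x\<bar> * norm (f \<bar>x\<bar>)))"
      using even_integral(1)[OF int] by simp
    then show ?thesis by (simp only: integrable_iff_bounded)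
  qed
  finally have fin: "(\<integral>\<^sup>+p. u p \<partial>(lborel \<Otimes>\<^sub>M lborel)) < \<infinity>" .
  have "(\<integral>\<^sup>+p. u (snd p, fst p) \<partial>(lborel \<Otimes>\<^sub>M lborel)) = (\<integral>\<^sup>+y. \<integral>\<^sup>+x. u (y, x) \<partial>lborel \<partial>lborel)"
    using lborel_pair.nn_integral_snd[OF us] by simp
  also have "\<dots> = (\<integral>\<^sup>+p. u p \<partial>(lborel \<Otimes>\<^sub>M lborel))" by (rule lborel.nn_integral_fst[OF um])
  finally have fin': "(\<integral>\<^sup>+p. u (snd p, fst p) \<partial>(lborel \<Otimes>\<^sub>M lborel)) < \<infinity>" using fin by simp
  have "(\<integral>\<^sup>+p. ennreal (norm (max_fun f p)) \<partial>(lborel \<Otimes>\<^sub>M lborel))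
      \<le> (\<integral>\<^sup>+p. u p + u (snd p, fst p) \<partial>(lborel \<Otimes>\<^sub>M lborel))"
    by (rule nn_integral_mono) (auto simp: u_def max_fun_def max_def split: prod.splits)
  also have "\<dots> = (\<integral>\<^sup>+p. u p \<partial>(lborel \<Otimes>\<^sub>M lborel)) + (\<integral>\<^sup>+p. u (snd p, fst p) \<partial>(lborel \<Otimes>\<^sub>M lborel))"
    by (rule nn_integral_add) (rule um us)+
  also have "\<dots> < \<infinity>" using fin fin' by simp
  finally show ?thesis using meas by (simp add: integrable_iff_bounded)
qed

text \<open>Continuity settles the compact interval \<open>{0..1}\<close>; to its right the weight \<open>t\<close> is at least \<open>1\<close>.\<close>

lemma set_integrable_of_weighted:
  fixes f :: "real \<Rightarrow> complex"
  assumes cont: "continuous_on {0..} f" and int: "set_integrable lborel {0..} (\<lambda>t. t * norm (f t))"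
  shows "set_integrable lborel {0..} f"
proof -
  have "set_integrable lborel {0..1} f"
    by (rule borel_integrable_atLeastAtMost'[OF continuous_on_subset[OF cont]]) auto
  moreover have "set_integrable lborel {1..} f"
  proof (rule set_integrable_bound)
    show "set_integrable lborel {1..} (\<lambda>t. t * norm (f t))"
      by (rule set_integrable_subset[OF int]) auto
    show "set_borel_measurable lborel {1..} f"
      unfolding set_borel_measurable_def using continuous_on_subset[OF cont, of "{1..}"]
      by (simp add: borel_measurable_continuous_on_indicator)
    show "AE t in lborel. t \<in> {1..} \<longrightarrow> norm (f t) \<le> norm (t * norm (f t))"
      by (rule AE_I2) (auto simp: abs_mult mult_le_cancel_right1)
  qed
  ultimately have "set_integrable lborel ({0..1} \<union> {1..}) f" by (rule set_integrable_Un) auto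
  also have "{0..1} \<union> {1..} = {0::real..}" by auto
  finally show ?thesis .
qed

lemma fourier_max_fun_axis:
  fixes f :: "real \<Rightarrow> complex"
  assumes cont: "continuous_on {0..} f" and int: "set_integrable lborel {0..} (\<lambda>t. t * norm (f t))"
  shows "fourier (max_fun f) (s, 0) = 2 * fourier (companion f) s"
proof -
  note fi = set_integrable_of_weighted[OF assms]
  let ?e = "\<lambda>x. exp (- (\<i> * complex_of_real (x * s)))"
  let ?h = "\<lambda>p. max_fun f p * ?e (fst p)"
  have ne: "norm (?e x) = 1" for x using norm_exp_i_times[of "- (x * s)"] by simp
  have [measurable]: "?e \<in> borel_measurable borel" 
    by (intro borel_measurable_continuous_onI continuous_intros)
  have m[measurable]: "max_fun f \<in> borel_measurable (lborel \<Otimes>\<^sub>M lborel)"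
    using integrable_max_fun[OF assms] by simp
  have h: "integrable (lborel \<Otimes>\<^sub>M lborel) ?h"
    by (rule Bochner_Integration.integrable_bound[OF integrable_max_fun[OF assms]])
      (measurable, simp add: norm_mult ne)
  have "fourier (max_fun f) (s, 0) = (LINT p|(lborel \<Otimes>\<^sub>M lborel). ?h p)"
    unfolding fourier_def lborel_prod by (simp add: inner_prod_def split_def)
  also have "\<dots> = (LINT x|lborel. LINT y|lborel. ?h (x, y))"
    by (rule lborel_pair.integral_fst'[OF h, symmetric])
  also have "\<dots> = (LINT x|lborel. 2 * (companion f x * ?e x))"
  proof (rule Bochner_Integration.integral_cong[OF refl])
    fix x
    have "(LINT y|lborel. ?h (x, y)) = (LINT y|lborel. max_fun f (x, y)) * ?e x" by simp
    then show "(LINT y|lborel. ?h (x, y)) = 2 * (companion f x * ?e x)"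
      unfolding max_fun_section[OF fi] by (simp add: scaleR_conv_of_real)
  qed
  also have "\<dots> = 2 * fourier (companion f) s" by (simp add: fourier_def)
  finally show ?thesis .
qed

theorem mainTheorem6:
  fixes f0 :: "real \<Rightarrow> complex"
  assumes cont: "continuous_on {0..} f0"
    and ac: "AC_loc f0"
    and lim: "((\<lambda>t. t *\<^sub>R f0 t) \<longlongrightarrow> 0) at_top"
    and int: "set_integrable lborel {0..} (\<lambda>t. t * norm (f0 t))"
  shows "(\<forall>x. has_improper_integral (\<lambda>t. t *\<^sub>R vector_derivative f0 (at t)) \<bar>x\<bar> (- companion f0 x))
       \<and> (\<forall>x T. x \<noteq> 0 \<longrightarrow>
            (\<lambda>t. t *\<^sub>R vector_derivative f0 (at t)) absolutely_integrable_on {\<bar>x\<bar>..T})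
       \<and> integrable lborel (companion f0)
       \<and> ((\<forall>y. fourier (max_fun f0) y \<in> \<real>\<^sub>\<ge>\<^sub>0) \<longrightarrow> (\<forall>x. fourier (companion f0) x \<in> \<real>\<^sub>\<ge>\<^sub>0))"
proof (intro conjI allI impI)
  note fi = set_integrable_of_weighted[OF cont int]
  let ?d = "\<lambda>t. t *\<^sub>R vector_derivative f0 (at t)"
  fix x :: real
  show "has_improper_integral ?d \<bar>x\<bar> (- companion f0 x)"
    unfolding has_improper_integral_def
  proof (intro conjI allI impI)
    have hi: "(?d has_integral T *\<^sub>R f0 T - \<bar>x\<bar> *\<^sub>R f0 \<bar>x\<bar> - integral {\<bar>x\<bar>..T} f0) {\<bar>x\<bar>..T}" if "\<bar>x\<bar> < T" for T
      using weighted_derivative_integral_nonneg[OF cont ac _ that] by simp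
    show "?d integrable_on {\<bar>x\<bar>..T}" if "\<bar>x\<bar> \<le> T" for T
    proof (cases "\<bar>x\<bar> = T")
      case True
      then show ?thesis by (metis box_real(2) integrable_on_refl)
    qed (use hi[of T] that in \<open>auto simp: has_integral_integrable\<close>)
    have sx: "set_integrable lborel {\<bar>x\<bar>..} f0" by (rule set_integrable_subset[OF fi]) auto
    have "((\<lambda>T. LINT t:{\<bar>x\<bar>..T}|lborel. f0 t) \<longlongrightarrow> (LINT t:{\<bar>x\<bar>..}|lborel. f0 t)) at_top"
      by (rule tendsto_set_lebesgue_integral_at_top[OF _ sx]) simp
    moreover have "(LINT t:{\<bar>x\<bar>..T}|lborel. f0 t) = integral {\<bar>x\<bar>..T} f0" for T
      by (rule set_borel_integral_eq_integral(2)[OF set_integrable_subset[OF sx]]) auto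
    ultimately have "((\<lambda>T. integral {\<bar>x\<bar>..T} f0) \<longlongrightarrow> (LINT t:{\<bar>x\<bar>..}|lborel. f0 t)) at_top" by simp
    then have "((\<lambda>T. T *\<^sub>R f0 T - \<bar>x\<bar> *\<^sub>R f0 \<bar>x\<bar> - integral {\<bar>x\<bar>..T} f0) \<longlongrightarrow>
        0 - \<bar>x\<bar> *\<^sub>R f0 \<bar>x\<bar> - (LINT t:{\<bar>x\<bar>..}|lborel. f0 t)) at_top"
      by (intro tendsto_diff lim tendsto_const)
    moreover have "0 - \<bar>x\<bar> *\<^sub>R f0 \<bar>x\<bar> - (LINT t:{\<bar>x\<bar>..}|lborel. f0 t) = - companion f0 x"
      by (simp add: companion_def)
    moreover have "\<forall>\<^sub>F T in at_top. T *\<^sub>R f0 T - \<bar>x\<bar> *\<^sub>R f0 \<bar>x\<bar> - integral {\<bar>x\<bar>..T} f0 = integral {\<bar>x\<bar>..T} ?d"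
      using eventually_gt_at_top[of "\<bar>x\<bar>"] by eventually_elim (rule integral_unique[OF hi, symmetric])
    ultimately show "((\<lambda>T. integral {\<bar>x\<bar>..T} ?d) \<longlongrightarrow> - companion f0 x) at_top"
      by (simp add: Lim_transform_eventually)
  qed
  show "?d absolutely_integrable_on {\<bar>x\<bar>..T}" if "x \<noteq> 0" for T
  proof (cases "\<bar>x\<bar> < T")
    case True
    then show ?thesis
      using ac that by (intro weighted_derivative_integral(1)) (auto simp: AC_loc_def)
  next
    case False
    then have "negligible {\<bar>x\<bar>..T}" by (intro negligible_atLeastAtMostI) simp
    then show ?thesis by (rule absolutely_integrable_negligible)
  qed
  have "integrable lborel (\<lambda>x. LINT y|lborel. max_fun f0 (x, y))"
    by (rule lborel_pair.integrable_fst'[OF integrable_max_fun[OF cont int]])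
  then have double: "integrable lborel (\<lambda>x. 2 *\<^sub>R companion f0 x)"
    unfolding max_fun_section[OF fi] .
  have "integrable lborel (\<lambda>x. (1/2) *\<^sub>R (2 *\<^sub>R companion f0 x))"
    by (rule integrable_scaleR_right) (rule double)
  then show "integrable lborel (companion f0)" by simp
  assume "\<forall>y. fourier (max_fun f0) y \<in> \<real>\<^sub>\<ge>\<^sub>0"
  then have "2 * fourier (companion f0) x \<in> \<real>\<^sub>\<ge>\<^sub>0"
    using fourier_max_fun_axis[OF cont int] by metis
  then show "fourier (companion f0) x \<in> \<real>\<^sub>\<ge>\<^sub>0"
    by (simp add: complex_nonneg_Reals_iff)
qed

end
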